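(* Work in Vopěnka's Alternative Set Theory. Let $\tau\in N\setminus\mathit{FN}$, let $\varepsilon=\frac{1}{\tau}$, and let $[0,1]_\varepsilon=\left\{\frac{n}{\tau}\,;\,n\in N,\ 0\le n\le\tau\right\}$. Let $\mathscr{F}$ be a differentiable real function on $[0,1]$, and let $f$ be a rational-valued function on $[0,1]_\varepsilon$ representing $\mathscr{F}$ whose difference quotient function $\frac{\Delta f}{\Delta x}$ is continuous. Then for every $x\in[0,1]_\varepsilon$, \[ \lim_{t\rightarrow 0}\frac{f(x+t)-f(x)}{t}\ \doteq\ \frac{\Delta f}{\Delta x}(x), \] meaning: for a decreasing sequence $(a_n)_{n\in\mathit{FN}}$ of nonzero elements of $[0,1]_\varepsilon$ with $x+a_n\in[0,1]_\varepsilon$, $a_n\not\doteq 0$ for all $n\in\mathit{FN}$, and $\lim_{n\in\mathit{FN}}a_n\doteq 0$, one has \[ (\forall q\in\mathit{FQ},\,q\neq 0)(\exists i\in\mathit{FN})(\forall j\in\mathit{FN},\,j>i)\left(\left|\frac{f(x+a_j)-f(x)}{a_j}-\frac{\Delta f}{\Delta x}(x)\right|<|q|\right). \]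
   Context: Setting: Vopěnka's Alternative Set Theory (AST). $N$ is the class of natural numbers, $\mathit{FN}\subseteq N$ the class of finite natural numbers (those $x\in N$ all of whose subclasses are sets); elements of $N\setminus\mathit{FN}$ are infinite natural numbers. $Z$, $Q$ are the integers and rationals; $\mathit{FQ}=\{q\in Q;\ (\exists x,y\in\mathit{FN})(q=\pm x/y)\}$ are the finite rationals, and $\mathit{BQ}=\{q\in Q;\ (\exists i\in\mathit{FN})(|q|\le i)\}$ the bounded rationals. Letters $i,j,k$ range over $\mathit{FN}$. Indiscernibility on $Q$: $p\doteq q$ iff either $(\exists k)(\forall i>0)(|p|<k\wedge|p-q|<1/i)$, or $(\forall k)((p>k\wedge q>k)\vee(p<-k\wedge q<-k))$. The monad of $q$ is $\mathrm{Mon}(q)=\{s\in Q;\ s\doteq q\}$; real numbers are monads of bounded rationals, $R=\mathit{BQ}/\doteq$, and the real continuum is $\langle Q,\doteq\rangle$. A function $F$ between classes carrying indiscernibility relations is continuous if $x\doteq y$ implies $F(x)\doteq F(y)$; two such functions are indiscernible, $F\doteq G$, if $F(x)\doteq G(x)$ for all $x$. A real function on $[0,1]$ is a morphism, i.e. the class $[F]$ of all functions indiscernible from a continuous function $F:[0,1]_Q\to Q$ (where $[0,1]_Q=\{z\in Q;\,0\le z\le 1\}$), and $F$ is said to represent it. With $\kappa_\varepsilon(s)=\left[\frac{s}{\varepsilon}\right]\varepsilon$ ($[\cdot]$ the integer part), a real function $\mathscr{F}$ is represented by a continuous rational-valued $f$ on $[0,1]_\varepsilon$ if $f\circ\kappa_\varepsilon$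 represents $\mathscr{F}$. For $x\in[0,1]_\varepsilon\setminus\{1\}$, $x^+=x+\Delta x$ with $\Delta x=\varepsilon$, and the difference quotient is $\frac{\Delta f}{\Delta x}(x)=\frac{f(x^+)-f(x)}{\Delta x}$. $\mathscr{F}$ is differentiable if it is represented by such an $f$ whose difference quotient function $\frac{\Delta f}{\Delta x}$ is continuous. A rational sequence $(a_i)_{i\in\mathit{FN}}$ converges to $x$, written $\lim_{i\in\mathit{FN}}a_i\doteq x$, iff $(\forall q\in\mathit{FQ})(\exists i\in\mathit{FN})(\forall j>i)(|a_j-x|<|q|)$.
   Formalization: The formal theorem assumes in addition that the difference quotient at x is a bounded rational (the claim fails for a square root at x = 0) and takes f to be a set, not a proper class (it fails for a class function constant on monads representing the identity). *)

theory Defs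
  imports Main
begin

text \<open>
  Vopenka's Alternative Set Theory, axiomatised as a type class: the elements of the type are the
  sets of the theory, and its classes are the members of a distinguished collection of HOL sets of
  such elements.  Apart from the comprehension schema nothing is assumed about that collection (it
  need not contain every HOL set), so that the models of the type class are, up to isomorphism,
  exactly the models of the first-order theory.
\<close>

text \<open>
  Formulas of the language with set and class variables.  \<open>FMem i j\<close>: the set \<open>x\<^sub>i\<close> is an element
  of the set \<open>x\<^sub>j\<close>; \<open>FIn i j\<close>: the set \<open>x\<^sub>i\<close> is an element of the class \<open>X\<^sub>j\<close>.  Equality of classes,
  and membership of a class that is a set, are expressible by these.
\<close>

datatype fm =
    FMem nat nat
  | FEq nat nat
  | FIn nat nat
  | FNeg fm
  | FConj fm fm
  | FAllSet nat fm
  | FAllClass nat fm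

primrec set_formula :: "fm \<Rightarrow> bool" where
  "set_formula (FMem i j) = True"
| "set_formula (FEq i j) = True"
| "set_formula (FIn i j) = False"
| "set_formula (FNeg p) = set_formula p"
| "set_formula (FConj p q) = (set_formula p \<and> set_formula q)"
| "set_formula (FAllSet i p) = set_formula p"
| "set_formula (FAllClass i p) = False"

class ast_base =
  fixes vmem :: "'a \<Rightarrow> 'a \<Rightarrow> bool"  (infix \<open>\<in>\<^sub>V\<close> 50)
    and classes :: "'a set set"
begin

primrec sat :: "fm \<Rightarrow> (nat \<Rightarrow> 'a) \<Rightarrow> (nat \<Rightarrow> 'a set) \<Rightarrow> bool" where
  "sat (FMem i j) s C = (s i \<in>\<^sub>V s j)"
| "sat (FEq i j) s C = (s i = s j)"
| "sat (FIn i j) s C = (s i \<in> C j)"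
| "sat (FNeg p) s C = (\<not> sat p s C)"
| "sat (FConj p q) s C = (sat p s C \<and> sat q s C)"
| "sat (FAllSet i p) s C = (\<forall>x. sat p (s(i := x)) C)"
| "sat (FAllClass i p) s C = (\<forall>X\<in>classes. sat p s (C(i := X)))"

definition elts :: "'a \<Rightarrow> 'a set" where
  "elts x = {y. y \<in>\<^sub>V x}"

definition vempty :: 'a where
  "vempty = (THE x. elts x = {})"

definition adjoin :: "'a \<Rightarrow> 'a \<Rightarrow> 'a" where
  "adjoin x y = (THE z. elts z = insert y (elts x))"

definition upair :: "'a \<Rightarrow> 'a \<Rightarrow> 'a" where
  "upair x y = adjoin (adjoin vempty x) y"

definition opair :: "'a \<Rightarrow> 'a \<Rightarrow> 'a" where
  "opair x y = upair (upair x x) (upair x y)"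

definition class_function :: "'a set \<Rightarrow> 'a set \<Rightarrow> 'a set \<Rightarrow> bool" where
  "class_function F A B \<longleftrightarrow> F \<in> classes
     \<and> (\<forall>p\<in>F. \<exists>x\<in>A. \<exists>y\<in>B. p = opair x y)
     \<and> (\<forall>x\<in>A. \<exists>!y. opair x y \<in> F)"

definition app :: "'a set \<Rightarrow> 'a \<Rightarrow> 'a" where
  "app F x = (THE y. opair x y \<in> F)"

definition equinumerous :: "'a set \<Rightarrow> 'a set \<Rightarrow> bool" where
  "equinumerous X Y \<longleftrightarrow> (\<exists>F. class_function F X Y \<and> bij_betw (app F) X Y)"

definition finite_class :: "'a set \<Rightarrow> bool" where
  "finite_class X \<longleftrightarrow> (\<forall>Y\<in>classes. Y \<subseteq> X \<longrightarrow> Y \<in> range elts)"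

definition naturals :: "'a set" where
  "naturals = {x. (\<forall>y\<in>elts x. elts y \<subseteq> elts x)
     \<and> (\<forall>y\<in>elts x. \<forall>z\<in>elts x. y \<in>\<^sub>V z \<or> y = z \<or> z \<in>\<^sub>V y)}"

definition finite_naturals :: "'a set" where
  "finite_naturals = {x \<in> naturals. finite_class (elts x)}"

definition countable_class :: "'a set \<Rightarrow> bool" where
  "countable_class X \<longleftrightarrow> equinumerous finite_naturals X"

definition uncountable_class :: "'a set \<Rightarrow> bool" where
  "uncountable_class X \<longleftrightarrow> \<not> finite_class X \<and> \<not> countable_class X"

definition fibre :: "'a set \<Rightarrow> 'a \<Rightarrow> 'a set" where
  "fibre R a = {x. opair a x \<in> R}"

definition vsuc :: "'a \<Rightarrow> 'a" where
  "vsuc n = adjoin n n"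

text \<open>\<open>viter g a n\<close> is the \<open>n\<close>-fold iterate of \<open>g\<close> from \<open>a\<close>, for a possibly infinite natural
  number \<open>n\<close>; the sequence of its values is required to be a set.\<close>

definition viter :: "('a \<Rightarrow> 'a) \<Rightarrow> 'a \<Rightarrow> 'a \<Rightarrow> 'a" where
  "viter g a n = (THE k. \<exists>h. class_function (elts h) (elts (vsuc n)) UNIV
     \<and> app (elts h) vempty = a
     \<and> (\<forall>i\<in>elts n. app (elts h) (vsuc i) = g (app (elts h) i))
     \<and> app (elts h) n = k)"

definition vadd :: "'a \<Rightarrow> 'a \<Rightarrow> 'a" where
  "vadd m n = viter vsuc m n"

definition vmult :: "'a \<Rightarrow> 'a \<Rightarrow> 'a" where
  "vmult m n = viter (\<lambda>k. vadd k m) vempty n"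

end

class ast = ast_base +
  assumes extensionality: "elts x = elts y \<Longrightarrow> x = y"
    and comprehension: "(\<And>i. C i \<in> classes) \<Longrightarrow> {x. sat p (s(0 := x)) C} \<in> classes"
    and empty_set: "\<exists>x. elts x = {}"
    and set_successor: "\<exists>z. elts z = insert y (elts x)"
    and set_induction: "set_formula p \<Longrightarrow> sat p (s(0 := vempty)) C
      \<Longrightarrow> (\<And>x y. sat p (s(0 := x)) C \<Longrightarrow> sat p (s(0 := adjoin x y)) C)
      \<Longrightarrow> sat p (s(0 := x)) C"
    and regularity: "set_formula p \<Longrightarrow> sat p (s(0 := x)) C
      \<Longrightarrow> \<exists>y. sat p (s(0 := y)) C \<and> (\<forall>z\<in>elts y. \<not> sat p (s(0 := z)) C)"
    and proper_semiset: "\<exists>x. \<exists>X\<in>classes. X \<subseteq> elts x \<and> X \<notin> range elts"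
    and prolongation: "class_function F X UNIV \<Longrightarrow> countable_class F
      \<Longrightarrow> \<exists>f A. class_function (elts f) A UNIV \<and> F \<subseteq> elts f"
    and extensional_coding: "R \<in> classes \<Longrightarrow> A \<in> classes
      \<Longrightarrow> \<exists>R'\<in>classes. \<exists>A'\<in>classes. fibre R ` A = fibre R' ` A' \<and> inj_on (fibre R') A'"
    and cardinalities: "X \<in> classes \<Longrightarrow> Y \<in> classes
      \<Longrightarrow> uncountable_class X \<Longrightarrow> uncountable_class Y \<Longrightarrow> equinumerous X Y"
begin

lemma elts_vempty [simp]: "elts vempty = {}"
  unfolding vempty_def using empty_set extensionality by (metis (mono_tags, lifting) theI')

lemma elts_adjoin [simp]: "elts (adjoin x y) = insert y (elts x)"
  unfolding adjoin_def
  by (rule theI') (use set_successor[of y x] extensionality in auto)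

lemma vempty_natural: "vempty \<in> naturals"
  by (simp add: naturals_def)

lemma vsuc_vempty_natural: "vsuc vempty \<in> naturals"
  by (simp add: naturals_def vsuc_def)

end

typedef (overloaded) 'a anat = "naturals :: 'a::ast set"
  using vempty_natural by blast

instantiation anat :: (ast) "{zero, one, plus, times, ord}"
begin

definition zero_anat :: "'a anat" where
  "0 = Abs_anat vempty"

definition one_anat :: "'a anat" where
  "1 = Abs_anat (vsuc vempty)"

definition plus_anat :: "'a anat \<Rightarrow> 'a anat \<Rightarrow> 'a anat" where
  "m + n = Abs_anat (vadd (Rep_anat m) (Rep_anat n))"

definition times_anat :: "'a anat \<Rightarrow> 'a anat \<Rightarrow> 'a anat" where
  "m * n = Abs_anat (vmult (Rep_anat m) (Rep_anat n))"

definition less_anat :: "'a anat \<Rightarrow> 'a anat \<Rightarrow> bool" where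
  "m < n \<longleftrightarrow> Rep_anat m \<in>\<^sub>V Rep_anat n"

definition less_eq_anat :: "'a anat \<Rightarrow> 'a anat \<Rightarrow> bool" where
  "m \<le> n \<longleftrightarrow> m < n \<or> m = (n :: 'a anat)"

instance ..

end

definition FN :: "'a::ast anat set" where
  "FN = {n. Rep_anat n \<in> finite_naturals}"

text \<open>
  The triple \<open>a b c\<close> stands for \<open>(a - b) / c\<close>.  Each rational number is a set, namely the code of
  the one representing triple with \<open>a = 0\<close> or \<open>b = 0\<close> and least possible denominator; so functions
  between rational numbers are classes (or sets) of ordered pairs of such codes.
\<close>

definition same_frac ::
  "'a::ast anat \<Rightarrow> 'a anat \<Rightarrow> 'a anat \<Rightarrow> 'a anat \<Rightarrow> 'a anat \<Rightarrow> 'a anat \<Rightarrow> bool" where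
  "same_frac a b c a' b' c' \<longleftrightarrow> a * c' + b' * c = a' * c + b * c'"

definition lowest_terms :: "'a::ast anat \<Rightarrow> 'a anat \<Rightarrow> 'a anat \<Rightarrow> bool" where
  "lowest_terms a b c \<longleftrightarrow> c \<noteq> 0 \<and> (a = 0 \<or> b = 0)
     \<and> (\<forall>a' b' c'. c' \<noteq> 0 \<longrightarrow> same_frac a b c a' b' c' \<longrightarrow> \<not> c' < c)"

definition rat_code :: "'a::ast anat \<Rightarrow> 'a anat \<Rightarrow> 'a anat \<Rightarrow> 'a" where
  "rat_code a b c = opair (Rep_anat a) (opair (Rep_anat b) (Rep_anat c))"

lemma lowest_terms_0: "lowest_terms 0 0 (1 :: 'a::ast anat)"
proof -
  have rep0: "Rep_anat (0 :: 'a anat) = vempty"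
    by (simp add: zero_anat_def Abs_anat_inverse vempty_natural)
  have rep1: "elts (Rep_anat (1 :: 'a anat)) = {vempty}"
    unfolding one_anat_def Abs_anat_inverse[OF vsuc_vempty_natural] by (simp add: vsuc_def)
  have "n = 0" if "n < (1 :: 'a anat)" for n
    using that rep0 rep1 by (auto simp: less_anat_def elts_def Rep_anat_inject[symmetric])
  moreover have "(1 :: 'a anat) \<noteq> 0"
    using rep0 rep1 by (metis elts_vempty insert_not_empty)
  ultimately show ?thesis
    by (auto simp: lowest_terms_def)
qed

typedef (overloaded) 'a arat = "{rat_code a b c | a b c :: 'a::ast anat. lowest_terms a b c}"
  using lowest_terms_0 by blast

definition afrac :: "'a::ast anat \<Rightarrow> 'a anat \<Rightarrow> 'a anat \<Rightarrow> 'a arat" where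
  "afrac a b c = (THE q. \<exists>a' b' c'. lowest_terms a' b' c' \<and> same_frac a b c a' b' c'
     \<and> Rep_arat q = rat_code a' b' c')"

definition pos_num :: "'a::ast arat \<Rightarrow> 'a anat" where
  "pos_num q = (THE a. \<exists>b c. Rep_arat q = rat_code a b c)"

definition neg_num :: "'a::ast arat \<Rightarrow> 'a anat" where
  "neg_num q = (THE b. \<exists>a c. Rep_arat q = rat_code a b c)"

definition denom :: "'a::ast arat \<Rightarrow> 'a anat" where
  "denom q = (THE c. \<exists>a b. Rep_arat q = rat_code a b c)"

instantiation arat :: (ast) "{zero, one, plus, uminus, minus, times, inverse, ord, abs}"
begin

definition zero_arat :: "'a arat" where
  "0 = afrac 0 0 1"

definition one_arat :: "'a arat" where
  "1 = afrac 1 0 1"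

definition plus_arat :: "'a arat \<Rightarrow> 'a arat \<Rightarrow> 'a arat" where
  "p + q = afrac (pos_num p * denom q + pos_num q * denom p)
                (neg_num p * denom q + neg_num q * denom p)
                (denom p * denom q)"

definition uminus_arat :: "'a arat \<Rightarrow> 'a arat" where
  "- p = afrac (neg_num p) (pos_num p) (denom p)"

definition minus_arat :: "'a arat \<Rightarrow> 'a arat \<Rightarrow> 'a arat" where
  "p - q = p + (- q :: 'a arat)"

definition times_arat :: "'a arat \<Rightarrow> 'a arat \<Rightarrow> 'a arat" where
  "p * q = afrac (pos_num p * pos_num q + neg_num p * neg_num q)
                (pos_num p * neg_num q + neg_num p * pos_num q)
                (denom p * denom q)"

definition inverse_arat :: "'a arat \<Rightarrow> 'a arat" where
  "inverse p = (if pos_num p \<noteq> 0 then afrac (denom p) 0 (pos_num p)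
                else if neg_num p \<noteq> 0 then afrac 0 (denom p) (neg_num p)
                else 0)"

definition divide_arat :: "'a arat \<Rightarrow> 'a arat \<Rightarrow> 'a arat" where
  "p div q = p * (inverse q :: 'a arat)"

definition less_arat :: "'a arat \<Rightarrow> 'a arat \<Rightarrow> bool" where
  "p < q \<longleftrightarrow> pos_num p * denom q + neg_num q * denom p
           < pos_num q * denom p + neg_num p * denom q"

definition less_eq_arat :: "'a arat \<Rightarrow> 'a arat \<Rightarrow> bool" where
  "p \<le> q \<longleftrightarrow> p < q \<or> p = (q :: 'a arat)"

definition abs_arat :: "'a arat \<Rightarrow> 'a arat" where
  "\<bar>p\<bar> = (if p < 0 then - p else p :: 'a arat)"

instance ..

end

definition of_anat :: "'a::ast anat \<Rightarrow> 'a arat" where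
  "of_anat n = afrac n 0 1"

definition AInts :: "'a::ast arat set" where
  "AInts = range of_anat \<union> range (\<lambda>n. - of_anat n)"

definition FQ :: "'a::ast arat set" where
  "FQ = {q. \<exists>x\<in>FN. \<exists>y\<in>FN. y \<noteq> 0 \<and>
           (q = of_anat x / of_anat y \<or> q = - (of_anat x / of_anat y))}"

definition BQ :: "'a::ast arat set" where
  "BQ = {q. \<exists>i\<in>FN. \<bar>q\<bar> \<le> of_anat i}"

definition indisc :: "'a::ast arat \<Rightarrow> 'a arat \<Rightarrow> bool"  (infix \<open>\<doteq>\<close> 50) where
  "p \<doteq> q \<longleftrightarrow>
     (\<exists>k\<in>FN. \<forall>i\<in>FN. 0 < i \<longrightarrow> \<bar>p\<bar> < of_anat k \<and> \<bar>p - q\<bar> < 1 / of_anat i)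
   \<or> (\<forall>k\<in>FN. (of_anat k < p \<and> of_anat k < q) \<or> (p < - of_anat k \<and> q < - of_anat k))"

definition rat_function :: "'a::ast set \<Rightarrow> 'a arat set \<Rightarrow> bool" where
  "rat_function F D \<longleftrightarrow> class_function F (Rep_arat ` D) (range Rep_arat)"

definition rapp :: "'a::ast set \<Rightarrow> 'a arat \<Rightarrow> 'a arat" where
  "rapp F s = Abs_arat (app F (Rep_arat s))"

definition indisc_continuous :: "'a::ast arat set \<Rightarrow> ('a arat \<Rightarrow> 'a arat) \<Rightarrow> bool" where
  "indisc_continuous D g \<longleftrightarrow> (\<forall>x\<in>D. \<forall>y\<in>D. x \<doteq> y \<longrightarrow> g x \<doteq> g y)"

definition unitQ :: "'a::ast arat set" where
  "unitQ = {z. 0 \<le> z \<and> z \<le> 1}"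

definition morphism :: "'a::ast set \<Rightarrow> 'a set set" where
  "morphism F = {G. rat_function G unitQ \<and> (\<forall>x\<in>unitQ. rapp F x \<doteq> rapp G x)}"

definition represents :: "'a::ast set \<Rightarrow> 'a set set \<Rightarrow> bool" where
  "represents F \<F> \<longleftrightarrow>
     rat_function F unitQ \<and> indisc_continuous unitQ (rapp F) \<and> \<F> = morphism F"

definition real_function :: "'a::ast set set \<Rightarrow> bool" where
  "real_function \<F> \<longleftrightarrow> (\<exists>F. represents F \<F>)"

definition eps :: "'a::ast anat \<Rightarrow> 'a arat" where
  "eps \<tau> = 1 / of_anat \<tau>"

definition grid :: "'a::ast anat \<Rightarrow> 'a arat set" where
  "grid \<tau> = {of_anat n / of_anat \<tau> | n. 0 \<le> n \<and> n \<le> \<tau>}"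

definition int_part :: "'a::ast arat \<Rightarrow> 'a arat" where
  "int_part q = (THE z. z \<in> AInts \<and> z \<le> q \<and> q < z + 1)"

definition kappa :: "'a::ast anat \<Rightarrow> 'a arat \<Rightarrow> 'a arat" where
  "kappa \<tau> s = int_part (s / eps \<tau>) * eps \<tau>"

definition comp_kappa :: "'a::ast anat \<Rightarrow> 'a \<Rightarrow> 'a set" where
  "comp_kappa \<tau> f = {opair (Rep_arat s) (Rep_arat (rapp (elts f) (kappa \<tau> s))) | s. s \<in> unitQ}"

text \<open>Here \<open>f\<close> is an element of the universe, that is, a set.  This is essential: a proper class
  function with values \<open>f x \<doteq> x\<close> that is constant on each monad is continuous and has difference
  quotient 0, although it represents the identity.\<close>

definition grid_represents :: "'a::ast anat \<Rightarrow> 'a \<Rightarrow> 'a set set \<Rightarrow> bool" where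
  "grid_represents \<tau> f \<F> \<longleftrightarrow> rat_function (elts f) (grid \<tau>)
     \<and> indisc_continuous (grid \<tau>) (rapp (elts f)) \<and> represents (comp_kappa \<tau> f) \<F>"

definition diff_quot :: "'a::ast anat \<Rightarrow> 'a \<Rightarrow> 'a arat \<Rightarrow> 'a arat" where
  "diff_quot \<tau> f x = (rapp (elts f) (x + eps \<tau>) - rapp (elts f) x) / eps \<tau>"

definition ast_differentiable :: "'a::ast anat \<Rightarrow> 'a set set \<Rightarrow> bool" where
  "ast_differentiable \<tau> \<F> \<longleftrightarrow> real_function \<F> \<and>
     (\<exists>f. grid_represents \<tau> f \<F> \<and> indisc_continuous (grid \<tau> - {1}) (diff_quot \<tau> f))"

definition rat_sequence :: "'a::ast set \<Rightarrow> bool" where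
  "rat_sequence a \<longleftrightarrow> class_function a finite_naturals (range Rep_arat)"

definition seq_nth :: "'a::ast set \<Rightarrow> 'a anat \<Rightarrow> 'a arat" where
  "seq_nth a n = Abs_arat (app a (Rep_anat n))"

definition converges_to :: "'a::ast set \<Rightarrow> 'a arat \<Rightarrow> bool" where
  "converges_to a x \<longleftrightarrow>
     (\<forall>q\<in>FQ. q \<noteq> 0 \<longrightarrow> (\<exists>i\<in>FN. \<forall>j\<in>FN. i < j \<longrightarrow> \<bar>seq_nth a j - x\<bar> < \<bar>q\<bar>))"

end

theory Submission
  imports Defs "HOL-Computational_Algebra.Fraction_Field"
begin

text \<open>
  For an infinite natural number \<open>k\<close>, the bound \<open>k |y - x| < 1\<close> makes \<open>y\<close> indiscernible from \<open>x\<close>, so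
  continuity of the difference quotient \<open>g\<close> gives \<open>|g y - g x| < 1 / i\<close>.  Since \<open>f\<close> is a set, the
  implication is expressed by a set formula in \<open>k\<close>; the least \<open>k\<close> satisfying it for all \<open>y\<close> is
  therefore finite.  For \<open>t = m \<epsilon> < 1 / k\<close>, induction on the possibly infinite number \<open>m\<close> sums the
  increments \<open>\<epsilon> g y\<close> between \<open>x\<close> and \<open>x + t\<close> and yields
  \<open>|f (x + t) - f x - t g x| \<le> t / i\<close>.

  Both steps use induction, which holds for set formulas only; hence the arithmetic of natural and
  rational numbers has to be shown definable by set formulas.
\<close>

subsection \<open>Definability by set formulas\<close>

text \<open>The relation \<open>\<doteq>\<close> quantifies over the finite numbers, which no set
  formula can single out, so continuity cannot be used inside an induction as it stands. The bound
  \<open>k |y - x| < 1\<close> is the substitute: on the grid it implies indiscernibility when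
  \<open>k\<close> is infinite, and when \<open>k\<close> is finite it describes a neighbourhood of
  finite rational radius, which a sequence tending to 0 eventually enters. Boundedness of the
  quotient at \<open>x\<close> turns indiscernible quotients into close ones, since two values above
  every finite number are indiscernible at any distance. The operations of arithmetic are given by
  iteration along set sequences and by descriptions, so their definability rests on a recursion
  theorem proved inside the theory. Rationals are then mapped injectively into the fraction field of
  formal differences, which makes the remaining estimates ordinary ordered field algebra.\<close>

text \<open>Environments are addressed by de Bruijn indices, so that closure under quantifiers is a
  higher-order pattern rule and definability goals are solved by \<open>intro\<close>.\<close>

inductive sdef :: "((nat \<Rightarrow> 'a::ast) \<Rightarrow> bool) \<Rightarrow> bool" where
  mem: "sdef (\<lambda>e. e i \<in>\<^sub>V e j)"
| eq: "sdef (\<lambda>e. e i = e j)"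
| neg: "sdef P \<Longrightarrow> sdef (\<lambda>e. \<not> P e)"
| conj: "sdef P \<Longrightarrow> sdef Q \<Longrightarrow> sdef (\<lambda>e. P e \<and> Q e)"
| all: "sdef P \<Longrightarrow> sdef (\<lambda>e. \<forall>x. P (case_nat x e))"
| param: "sdef P \<Longrightarrow> sdef (\<lambda>e. P (case_nat c e))"

section \<open>Translation of definable predicates into formulas with parameters\<close>

primrec ren :: "(nat \<Rightarrow> nat) \<Rightarrow> fm \<Rightarrow> fm" where
  "ren r (FMem i j) = FMem (r i) (r j)"
| "ren r (FEq i j) = FEq (r i) (r j)"
| "ren r (FIn i j) = FIn (r i) j"
| "ren r (FNeg p) = FNeg (ren r p)"
| "ren r (FConj p q) = FConj (ren r p) (ren r q)"
| "ren r (FAllSet i p) = FAllSet (r i) (ren r p)"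
| "ren r (FAllClass i p) = FAllClass i (ren r p)"

lemma set_formula_ren: "set_formula (ren r p) = set_formula p"
  by (induction p) auto

text \<open>Bound set variables are renamed along with free ones, so injectivity is what prevents
  capture: an update at \<open>r i\<close> is seen by the variable \<open>i\<close> only.\<close>

lemma sat_ren:
  assumes "inj r"
  shows "sat (ren r p) s C = sat p (\<lambda>n. s (r n)) C"
proof (induction p arbitrary: s C)
  case (FAllSet i p)
  have "(\<lambda>n. (s(r i := x)) (r n)) = (\<lambda>n. s (r n))(i := x)" for x
    using assms by (auto simp: inj_eq)
  then show ?case
    using FAllSet by simp
qed auto

text \<open>Parameters of a definable predicate become the odd-numbered variables of its formula.\<close>

definition interleave :: "(nat \<Rightarrow> 'a) \<Rightarrow> (nat \<Rightarrow> 'a) \<Rightarrow> nat \<Rightarrow> 'a" where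
  "interleave e c n = (if even n then e (n div 2) else c (n div 2))"

text \<open>A permutation that moves de Bruijn variable 0 to the head of the parameter list: even
  slots drop by two, odd slots rise by two, and the freed slot 1 receives slot 0.\<close>

definition shift_even :: "nat \<Rightarrow> nat" where
  "shift_even n = (if n = 0 then 1 else if even n then n - 2 else n + 2)"

lemma inj_shift_even: "inj shift_even"
  by (rule inj_on_inverseI[where g = "\<lambda>n. if n = 1 then 0 else if even n then n + 2 else n - 2"])
    (auto simp: shift_even_def elim!: evenE, presburger)

text \<open>The dummy \<open>y\<close> merely reserves slot 1, which the update overwrites with
  \<open>x\<close>. One renaming thus serves both the quantifier, which binds slot 1, and the fixing
  of a parameter, where slot 1 already holds the right value.\<close>

lemma interleave_shift_even:
  "interleave (case_nat x e) c = (\<lambda>n. ((interleave e (case_nat y c))(1 := x)) (shift_even n))"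
proof
  fix n
  consider "n = 0" | m where "n = 2 * Suc m" | m where "n = Suc (2 * m)"
  proof (cases "even n")
    case True
    then obtain k where "n = 2 * k" by (elim evenE)
    then show ?thesis using that(1) that(2) by (cases k) auto
  next
    case False
    then obtain k where "n = 2 * k + 1" by (elim oddE)
    then show ?thesis using that(3) by simp
  qed
  then show "interleave (case_nat x e) c n = ((interleave e (case_nat y c))(1 := x)) (shift_even n)"
    by cases (auto simp: interleave_def shift_even_def)
qed

text \<open>The two halves of a conjunction bring separate parameter lists \<open>c\<close> and
  \<open>d\<close>. In \<open>interleave c d\<close>, seen as odd variables, the \<open>m\<close>-th
  member of \<open>c\<close> stands at \<open>4 * m + 1\<close> and that of \<open>d\<close> at
  \<open>4 * m + 3\<close>.\<close>

definition fst_params :: "nat \<Rightarrow> nat" where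
  "fst_params n = (if even n then n else 2 * n - 1)"

definition snd_params :: "nat \<Rightarrow> nat" where
  "snd_params n = (if even n then n else 2 * n + 1)"

lemma inj_params: "inj fst_params" "inj snd_params"
proof -
  show "inj fst_params"
    by (rule inj_on_inverseI[where g = "\<lambda>n. if even n then n else (n + 1) div 2"])
      (auto simp: fst_params_def elim!: oddE)
  show "inj snd_params"
    by (rule inj_on_inverseI[where g = "\<lambda>n. if even n then n else (n - 1) div 2"])
      (auto simp: snd_params_def elim!: oddE)
qed

lemma interleave_params:
  "(\<lambda>n. interleave e (interleave c d) (fst_params n)) = interleave e c"
  "(\<lambda>n. interleave e (interleave c d) (snd_params n)) = interleave e d"
proof -
  have "interleave e (interleave c d) (fst_params n) = interleave e c n
      \<and> interleave e (interleave c d) (snd_params n) = interleave e d n" for n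
  proof (cases "even n")
    case True
    then show ?thesis by (simp add: interleave_def fst_params_def snd_params_def)
  next
    case False
    then obtain m where "n = 2 * m + 1" by (elim oddE)
    then show ?thesis by (simp add: interleave_def fst_params_def snd_params_def)
  qed
  then show "(\<lambda>n. interleave e (interleave c d) (fst_params n)) = interleave e c"
    "(\<lambda>n. interleave e (interleave c d) (snd_params n)) = interleave e d"
    by auto
qed

lemma sat_shift_even:
  "sat (ren shift_even p) ((interleave e (case_nat y c))(1 := x)) C
     = sat p (interleave (case_nat x e) c) C"
  by (simp only: sat_ren[OF inj_shift_even] interleave_shift_even[of x e c y])

text \<open>The bridge from \<open>sdef\<close> to the axiom schemas. The class assignment
  \<open>C\<close> is arbitrary because set formulas contain no class variables.\<close>

lemma sdef_formula:
  fixes P :: "(nat \<Rightarrow> 'a::ast) \<Rightarrow> bool"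
  assumes "sdef P"
  shows "\<exists>p c. set_formula p \<and> (\<forall>e C. P e = sat p (interleave e c) C)"
  using assms
proof induction
  case (mem i j)
  show ?case
    by (intro exI[of _ "FMem (2 * i) (2 * j)"]) (simp add: interleave_def)
next
  case (eq i j)
  show ?case
    by (intro exI[of _ "FEq (2 * i) (2 * j)"]) (simp add: interleave_def)
next
  case (neg P)
  then obtain p c where "set_formula p" "\<And>e C. P e = sat p (interleave e c) C" by blast
  then show ?case
    by (intro exI[of _ "FNeg p"] exI[of _ c]) simp
next
  case (conj P Q)
  then obtain p c q d where "set_formula p" "\<And>e C. P e = sat p (interleave e c) C"
    "set_formula q" "\<And>e C. Q e = sat q (interleave e d) C" by blast
  then show ?case
    by (intro exI[of _ "FConj (ren fst_params p) (ren snd_params q)"] exI[of _ "interleave c d"])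
      (simp add: set_formula_ren sat_ren inj_params interleave_params)
next
  case (all P)
  then obtain p c where "set_formula p" "\<And>e C. P e = sat p (interleave e c) C" by blast
  \<comment> \<open>The quantifier binds variable 1, which is where \<open>shift_even\<close> puts
    de Bruijn variable 0; the head of the parameter list is only a placeholder for it.\<close>
  then show ?case
    by (intro exI[of _ "FAllSet 1 (ren shift_even p)"] exI[of _ "case_nat undefined c"])
      (simp add: set_formula_ren sat_shift_even[unfolded One_nat_def])
next
  case (param P a)
  then obtain p c where "set_formula p" "\<And>e C. P e = sat p (interleave e c) C" by blast
  moreover have "(interleave e (case_nat a c))(1 := a) = interleave e (case_nat a c)" for e
    by (auto simp: interleave_def)
  ultimately show ?case
    using sat_shift_even[of p _ a c a]
    by (intro exI[of _ "ren shift_even p"] exI[of _ "case_nat a c"]) (simp add: set_formula_ren)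
qed

lemma sdef_True: "sdef (\<lambda>e. True)"
  using sdef.eq[of 0 0] by simp

lemma sdef_const: "sdef (\<lambda>e. b)"
  using sdef_True sdef.neg[OF sdef_True] by (cases b) auto

text \<open>\<open>Inl\<close> renames a variable and \<open>Inr\<close> fixes it to a parameter.
  Infinitely many variables may be fixed at once, because every atom looks at only two of
  them.\<close>

lemma sdef_subst_env:
  assumes "sdef P"
  shows "sdef (\<lambda>e. P (\<lambda>n. case s n of Inl i \<Rightarrow> e i | Inr c \<Rightarrow> c))"
  using assms
proof (induction arbitrary: s)
  case (mem i j)
  show ?case
    using sdef.mem[of "projl (s i)" "projl (s j)"]
      sdef.param[OF sdef.mem[of 0 "Suc (projl (s j))"], of "projr (s i)"]
      sdef.param[OF sdef.mem[of "Suc (projl (s i))" 0], of "projr (s j)"]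
    by (cases "s i"; cases "s j") (simp_all add: sdef_const)
next
  case (eq i j)
  show ?case
    using sdef.eq[of "projl (s i)" "projl (s j)"]
      sdef.param[OF sdef.eq[of 0 "Suc (projl (s j))"], of "projr (s i)"]
      sdef.param[OF sdef.eq[of "Suc (projl (s i))" 0], of "projr (s j)"]
    by (cases "s i"; cases "s j") (simp_all add: sdef_const)
next
  case (all P)
  define s' where "s' = case_nat (Inl 0) (\<lambda>n. map_sum Suc id (s n))"
  have eq: "case_nat x (\<lambda>n. case s n of Inl i \<Rightarrow> e i | Inr c \<Rightarrow> c)
      = (\<lambda>n. case s' n of Inl i \<Rightarrow> case_nat x e i | Inr c \<Rightarrow> c)" for x and e :: "nat \<Rightarrow> 'a"
    by (auto simp: s'_def fun_eq_iff split: nat.split sum.split)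
  have "sdef (\<lambda>e. \<forall>x. P (\<lambda>n. case s' n of Inl i \<Rightarrow> case_nat x e i | Inr c \<Rightarrow> c))"
    by (rule sdef.all[OF all.IH[of s']])
  then show ?case
    by (subst eq)
next
  case (param P c)
  define s' where "s' = case_nat (Inl 0) (\<lambda>n. map_sum Suc id (s n))"
  have eq: "case_nat x (\<lambda>n. case s n of Inl i \<Rightarrow> e i | Inr c \<Rightarrow> c)
      = (\<lambda>n. case s' n of Inl i \<Rightarrow> case_nat x e i | Inr c \<Rightarrow> c)" for x and e :: "nat \<Rightarrow> 'a"
    by (auto simp: s'_def fun_eq_iff split: nat.split sum.split)
  have "sdef (\<lambda>e. P (\<lambda>n. case s' n of Inl i \<Rightarrow> case_nat c e i | Inr c \<Rightarrow> c))"
    by (rule sdef.param[OF param.IH[of s']])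
  then show ?case
    by (subst eq)
qed (auto intro: sdef.intros)

lemma sdef_rename:
  assumes "sdef P"
  shows "sdef (\<lambda>e. P (\<lambda>n. e (r n)))"
  using sdef_subst_env[OF assms, of "\<lambda>n. Inl (r n)"] by simp

section \<open>Closure under connectives and quantifiers\<close>

lemma sdef_disj:
  assumes "sdef P" "sdef Q"
  shows "sdef (\<lambda>e. P e \<or> Q e)"
proof -
  have "sdef (\<lambda>e. \<not> (\<not> P e \<and> \<not> Q e))"
    by (intro sdef.neg sdef.conj assms)
  then show ?thesis by simp
qed

lemma sdef_imp:
  assumes "sdef P" "sdef Q"
  shows "sdef (\<lambda>e. P e \<longrightarrow> Q e)"
  unfolding imp_conv_disj by (intro sdef.neg sdef_disj assms)

lemma sdef_iff:
  assumes "sdef P" "sdef Q"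
  shows "sdef (\<lambda>e. P e = Q e)"
  unfolding iff_conv_conj_imp by (intro sdef.conj sdef_imp assms)

lemma sdef_all:
  assumes "sdef (\<lambda>e. P (e 0) (\<lambda>n. e (Suc n)))"
  shows "sdef (\<lambda>e. \<forall>x. P x e)"
  using sdef.all[OF assms] by simp

lemma sdef_ex:
  assumes "sdef (\<lambda>e. P (e 0) (\<lambda>n. e (Suc n)))"
  shows "sdef (\<lambda>e. \<exists>x. P x e)"
proof -
  have "sdef (\<lambda>e. \<not> (\<forall>x. \<not> P x e))"
    by (intro sdef.neg sdef_all assms)
  then show ?thesis by simp
qed

section \<open>Definable terms and substitution\<close>

definition tdef :: "((nat \<Rightarrow> 'a) \<Rightarrow> 'a::ast) \<Rightarrow> bool" where
  "tdef u \<longleftrightarrow> sdef (\<lambda>e. e 0 = u (\<lambda>n. e (Suc n)))"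

lemma tdef_var: "tdef (\<lambda>e. e i)"
  unfolding tdef_def by (rule sdef.eq)

lemma tdef_const: "tdef (\<lambda>e. c)"
  using sdef.param[OF sdef.eq[of 1 0], of c] by (simp add: tdef_def)

lemma tdef_shift: "tdef u \<Longrightarrow> tdef (\<lambda>e. u (\<lambda>n. e (Suc n)))"
  unfolding tdef_def by (drule sdef_rename[where r = "case_nat 0 (\<lambda>n. Suc (Suc n))"]) simp

lemma tdef_shift2: "tdef u \<Longrightarrow> tdef (\<lambda>e. u (\<lambda>n. e (Suc (Suc n))))"
  by (rule tdef_shift[OF tdef_shift])

lemma tdef_shift3: "tdef u \<Longrightarrow> tdef (\<lambda>e. u (\<lambda>n. e (Suc (Suc (Suc n)))))"
  by (rule tdef_shift[OF tdef_shift2])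

text \<open>The recursion theorem below is stated for a function without further free variables;
  freezing the environment reduces the general case to it.\<close>

lemma tdef_fix_params:
  assumes "tdef (\<lambda>e. g (e 0) (\<lambda>n. e (Suc n)))"
  shows "tdef (\<lambda>e. g (e 0) c)"
  unfolding tdef_def
  using sdef_subst_env[OF assms[unfolded tdef_def],
      of "case_nat (Inl 0) (case_nat (Inl 1) (\<lambda>n. Inr (c n)))"]
  by simp

text \<open>The language has no terms, so a defined term enters a predicate through its graph, at
  the cost of a quantifier over its value.\<close>

lemma sdef_subst:
  assumes "sdef (\<lambda>e. P (e 0) (\<lambda>n. e (Suc n)))" "tdef u"
  shows "sdef (\<lambda>e. P (u e) e)"
proof -
  have "sdef (\<lambda>e. \<exists>z. z = u e \<and> P z e)"
    using assms by (intro sdef_ex sdef.conj) (auto simp: tdef_def)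
  then show ?thesis by simp
qed

lemma sdef_subst1:
  assumes "sdef (\<lambda>e. P (e 0))" "tdef u"
  shows "sdef (\<lambda>e. P (u e))"
  using assms by (rule sdef_subst)

lemma sdef_subst2:
  assumes "sdef (\<lambda>e. P (e 0) (e 1))" "tdef u" "tdef v"
  shows "sdef (\<lambda>e. P (u e) (v e))"
proof -
  have "sdef (\<lambda>e. P (e 1) (e 0))"
    using sdef_rename[OF assms(1), of "case_nat 1 (case_nat 0 Suc)"] by simp
  then have "sdef (\<lambda>e. P (e 0) (v (\<lambda>n. e (Suc n))))"
    using assms(3) by (intro sdef_subst[of "\<lambda>z e. P (e 0) z"]) (auto intro: tdef_shift)
  then show ?thesis
    by (rule sdef_subst[OF _ assms(2)])
qed

lemma sdef_mem: "tdef u \<Longrightarrow> tdef v \<Longrightarrow> sdef (\<lambda>e. u e \<in>\<^sub>V v e)"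
  by (rule sdef_subst2[where P = "(\<in>\<^sub>V)"]) (auto intro: sdef.mem)

lemma sdef_eq: "tdef u \<Longrightarrow> tdef v \<Longrightarrow> sdef (\<lambda>e. u e = v e)"
  by (rule sdef_subst2[where P = "(=)"]) (auto intro: sdef.eq)

lemma sdef_elts: "tdef u \<Longrightarrow> tdef v \<Longrightarrow> sdef (\<lambda>e. u e \<in> elts (v e))"
  unfolding elts_def by (simp add: sdef_mem)

lemma sdef_ball:
  assumes "tdef u" "sdef (\<lambda>e. P (e 0) (\<lambda>n. e (Suc n)))"
  shows "sdef (\<lambda>e. \<forall>x\<in>elts (u e). P x e)"
  unfolding Ball_def
  by (intro sdef_all sdef_imp sdef_elts tdef_var tdef_shift[OF assms(1)] assms)

lemma sdef_bex:
  assumes "tdef u" "sdef (\<lambda>e. P (e 0) (\<lambda>n. e (Suc n)))"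
  shows "sdef (\<lambda>e. \<exists>x\<in>elts (u e). P x e)"
  unfolding Bex_def
  by (intro sdef_ex sdef.conj sdef_elts tdef_var tdef_shift[OF assms(1)] assms)

named_theorems sdef_intros

declare sdef.neg [sdef_intros] sdef.conj [sdef_intros] sdef_disj [sdef_intros]
  sdef_imp [sdef_intros] sdef_iff [sdef_intros] sdef_all [sdef_intros] sdef_ex [sdef_intros]
  sdef_ball [sdef_intros] sdef_bex [sdef_intros]
  sdef_mem [sdef_intros] sdef_eq [sdef_intros] sdef_elts [sdef_intros]
  sdef_const [sdef_intros] tdef_const [sdef_intros] tdef_var [sdef_intros]

lemma sdef_subset [sdef_intros]:
  assumes "tdef u" "tdef v"
  shows "sdef (\<lambda>e. elts (u e) \<subseteq> elts (v e))"
  unfolding subset_eq by (intro sdef_intros assms assms[THEN tdef_shift])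

section \<open>Induction and regularity for definable predicates\<close>

lemma set_induct:
  assumes "sdef (\<lambda>e. P (e 0))" "P vempty" "\<And>x y. P x \<Longrightarrow> P (adjoin x y)"
  shows "P x"
proof -
  obtain p c where p: "set_formula p" "\<And>e C. P (e 0) = sat p (interleave e c) C"
    using sdef_formula[OF assms(1)] by blast
  \<comment> \<open>Only variable 0 and the parameters matter, so the other variables and all class
    variables receive arbitrary values.\<close>
  have P: "P x = sat p ((interleave (\<lambda>_. vempty) c)(0 := x)) (\<lambda>_. {})" for x
  proof -
    have "(interleave (\<lambda>_. vempty) c)(0 := x) = interleave ((\<lambda>_. vempty)(0 := x)) c"
      by (rule ext) (auto simp: interleave_def elim!: evenE)
    then show ?thesis using p(2)[of "(\<lambda>_. vempty)(0 := x)"] by simp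
  qed
  show ?thesis
    unfolding P by (rule set_induction[OF p(1)]) (use assms(2,3) in \<open>auto simp: P\<close>)
qed

lemma set_minimal:
  assumes "sdef (\<lambda>e. P (e 0))" "P x"
  shows "\<exists>y. P y \<and> (\<forall>z\<in>elts y. \<not> P z)"
proof -
  obtain p c where p: "set_formula p" "\<And>e C. P (e 0) = sat p (interleave e c) C"
    using sdef_formula[OF assms(1)] by blast
  have P: "P x = sat p ((interleave (\<lambda>_. vempty) c)(0 := x)) (\<lambda>_. {})" for x
  proof -
    have "(interleave (\<lambda>_. vempty) c)(0 := x) = interleave ((\<lambda>_. vempty)(0 := x)) c"
      by (rule ext) (auto simp: interleave_def elim!: evenE)
    then show ?thesis using p(2)[of "(\<lambda>_. vempty)(0 := x)"] by simp
  qed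
  show ?thesis
    using assms(2) unfolding P by (rule regularity[OF p(1)])
qed

subsection \<open>Natural numbers of the theory\<close>

lemma vmem_iff: "x \<in>\<^sub>V y \<longleftrightarrow> x \<in> elts y"
  by (simp add: elts_def)

lemma sdef_naturals: 
  assumes "tdef u"
  shows "sdef (\<lambda>e. u e \<in> naturals)"
proof -
  have "sdef (\<lambda>e. e 0 \<in> naturals)"
    unfolding naturals_def mem_Collect_eq by (intro sdef_intros)
  then show ?thesis
    by (rule sdef_subst1[OF _ assms])
qed

text \<open>Regularity is applied to the definable collection of the three sets: a minimal one among
  them would still have its neighbour in the cycle as an element.\<close>

lemma no_three_cycle:
  fixes x y z :: "'a::ast"
  assumes "x \<in> elts y" "y \<in> elts z" "z \<in> elts x"
  shows False
proof -
  have "sdef (\<lambda>e. e 0 = x \<or> e 0 = y \<or> e 0 = z)"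
    by (intro sdef_intros)
  from set_minimal[OF this, of x] assms show False
    by auto
qed

lemma no_two_cycle:
  fixes x y :: "'a::ast"
  assumes "x \<in> elts y" "y \<in> elts x"
  shows False
proof -
  have "sdef (\<lambda>e. e 0 = x \<or> e 0 = y)"
    by (intro sdef_intros)
  from set_minimal[OF this, of x] assms show False
    by auto
qed

lemma not_self_member:
  fixes x :: "'a::ast"
  shows "x \<notin> elts x"
  using no_two_cycle[of x x] by auto

lemma natural_elts_subset:
  fixes n :: "'a::ast"
  assumes "n \<in> naturals" "y \<in> elts n"
  shows "elts y \<subseteq> elts n"
  using assms by (auto simp: naturals_def)

lemma natural_elts_linear:
  fixes n :: "'a::ast"
  assumes "n \<in> naturals" "y \<in> elts n" "z \<in> elts n"
  shows "y \<in> elts z \<or> y = z \<or> z \<in> elts y"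
  using assms by (auto simp: naturals_def vmem_iff)

text \<open>A natural number is only required to be transitive and linearly ordered by membership.
  Linearity leaves two other cases for \<open>x\<close> and \<open>z\<close>, and these would close
  membership cycles of length 2 or 3.\<close>

lemma natural_elts_trans:
  fixes n :: "'a::ast"
  assumes "n \<in> naturals" "x \<in> elts y" "y \<in> elts z" "z \<in> elts n"
  shows "x \<in> elts z"
proof -
  have "y \<in> elts n"
    by (rule subsetD[OF natural_elts_subset[OF assms(1,4)] assms(3)])
  from natural_elts_subset[OF assms(1) this] have "x \<in> elts n"
    by (rule subsetD[OF _ assms(2)])
  then have "x \<in> elts z \<or> x = z \<or> z \<in> elts x"
    by (rule natural_elts_linear[OF assms(1) _ assms(4)])
  then show ?thesis
    using no_two_cycle[OF assms(2)] no_three_cycle[OF assms(2,3)] assms(3) by fast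
qed

lemma natural_elts_natural:
  fixes n :: "'a::ast"
  assumes "n \<in> naturals" "y \<in> elts n"
  shows "y \<in> naturals"
proof -
  have "elts z \<subseteq> elts y" if "z \<in> elts y" for z
    by (rule subsetI) (rule natural_elts_trans[OF assms(1) _ that assms(2)])
  moreover have "elts y \<subseteq> elts n"
    by (rule natural_elts_subset[OF assms])
  ultimately show ?thesis
    using natural_elts_linear[OF assms(1)]
    unfolding naturals_def mem_Collect_eq vmem_iff by (meson subsetD)
qed

lemma elts_vsuc [simp]:
  fixes n :: "'a::ast"
  shows "elts (vsuc n) = insert n (elts n)"
  by (simp add: vsuc_def)

lemma vsuc_natural:
  fixes n :: "'a::ast"
  assumes "n \<in> naturals"
  shows "vsuc n \<in> naturals"
  using assms unfolding naturals_def by (auto simp: vmem_iff)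

text \<open>Set induction builds every set by adjoining single elements, so sets behave like finite
  ones, even those with infinitely many members. The existence of a maximum excludes limit ordinals
  and supplies predecessors.\<close>

lemma natural_subset_max:
  fixes n :: "'a::ast"
  assumes n: "n \<in> naturals" and x: "elts x \<subseteq> elts n" "elts x \<noteq> {}"
  shows "\<exists>m\<in>elts x. \<forall>y\<in>elts x. y \<in> elts m \<or> y = m"
proof -
  define P where "P x \<longleftrightarrow> elts x \<subseteq> elts n \<longrightarrow> (\<exists>y. y \<in> elts x) \<longrightarrow>
    (\<exists>m\<in>elts x. \<forall>y\<in>elts x. y \<in> elts m \<or> y = m)" for x
  have "P x"
  proof (rule set_induct[of P])
    show "sdef (\<lambda>e. P (e 0))"
      unfolding P_def by (intro sdef_intros)
    show "P vempty"
      by (simp add: P_def)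
    fix x y
    assume IH: "P x"
    show "P (adjoin x y)"
      unfolding P_def
    proof (intro impI)
      assume sub: "elts (adjoin x y) \<subseteq> elts n"
      show "\<exists>m\<in>elts (adjoin x y). \<forall>z\<in>elts (adjoin x y). z \<in> elts m \<or> z = m"
      proof (cases "elts x = {}")
        case False
        then obtain m where m: "m \<in> elts x" "\<And>z. z \<in> elts x \<Longrightarrow> z \<in> elts m \<or> z = m"
          using IH sub by (auto simp: P_def)
        have mn: "m \<in> elts n" "y \<in> elts n"
          using m sub by auto
        then consider "m \<in> elts y" | "y \<in> elts m \<or> y = m"
          using natural_elts_linear[OF n] by blast
        then show ?thesis
        proof cases
          case 1
          have "z \<in> elts y" if "z \<in> elts x" for z
            using m(2)[OF that] 1 natural_elts_trans[OF n _ 1 mn(2)] by blast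
          then show ?thesis by auto
        next
          case 2
          then show ?thesis using m by auto
        qed
      qed simp
    qed
  qed
  then show ?thesis
    using x by (auto simp: P_def)
qed

lemma natural_cases:
  fixes n :: "'a::ast"
  assumes "n \<in> naturals"
  obtains "n = vempty" | m where "m \<in> naturals" "n = vsuc m"
proof (cases "elts n = {}")
  case True
  then show ?thesis using that(1) extensionality[of n vempty] by simp
next
  case False
  then obtain m where m: "m \<in> elts n" "\<And>y. y \<in> elts n \<Longrightarrow> y \<in> elts m \<or> y = m"
    using natural_subset_max[OF assms, of n] by auto
  then have "elts n = elts (vsuc m)"
    using natural_elts_subset[OF assms m(1)] by auto
  then show ?thesis
    using that(2) extensionality natural_elts_natural[OF assms m(1)] by blast
qed

text \<open>The naturals are not defined as generated by \<open>vsuc\<close>. Induction comes from a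
  minimal counterexample, whose predecessor satisfies \<open>P\<close>.\<close>

lemma natural_induct:
  assumes "n \<in> naturals" "sdef (\<lambda>e. P (e 0))" "P vempty"
    and step: "\<And>n. n \<in> naturals \<Longrightarrow> P n \<Longrightarrow> P (vsuc n)"
  shows "P n"
proof (rule ccontr)
  assume "\<not> P n"
  have "sdef (\<lambda>e. e 0 \<in> naturals \<and> \<not> P (e 0))"
    by (intro sdef_intros sdef_naturals assms(2))
  from set_minimal[of "\<lambda>x. x \<in> naturals \<and> \<not> P x", OF this] assms(1) \<open>\<not> P n\<close>
  obtain m where m: "m \<in> naturals" "\<not> P m" "\<And>z. z \<in> elts m \<Longrightarrow> z \<in> naturals \<Longrightarrow> P z"
    by blast
  from m(1) show False
  proof (cases rule: natural_cases)
    case 1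
    then show False using m(2) assms(3) by simp
  next
    case (2 k)
    then show False using m(2,3) step[of k] by auto
  qed
qed

lemma vempty_in_vsuc:
  fixes n :: "'a::ast"
  assumes "n \<in> naturals"
  shows "vempty \<in> elts (vsuc n)"
proof -
  have "n = vempty \<or> vempty \<in> elts n"
  proof (rule natural_induct[OF assms, of "\<lambda>n. n = vempty \<or> vempty \<in> elts n"])
    show "sdef (\<lambda>e. e 0 = vempty \<or> vempty \<in> elts (e 0))"
      by (intro sdef_intros)
  qed auto
  then show ?thesis by auto
qed

lemma vset_eq_iff:
  fixes x y :: "'a::ast"
  shows "x = y \<longleftrightarrow> (\<forall>z. z \<in> elts x \<longleftrightarrow> z \<in> elts y)"
proof
  assume "\<forall>z. z \<in> elts x \<longleftrightarrow> z \<in> elts y"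
  then have "elts x = elts y" by (intro set_eqI) simp
  then show "x = y" by (rule extensionality)
qed simp

lemma vsuc_eq_iff:
  fixes x :: "'a::ast"
  shows "z = vsuc x \<longleftrightarrow> (\<forall>w. w \<in> elts z \<longleftrightarrow> w = x \<or> w \<in> elts x)"
  unfolding vset_eq_iff[of z] by simp

lemma tdef_vsuc [sdef_intros]:
  assumes "tdef u"
  shows "tdef (\<lambda>e. vsuc (u e))"
  unfolding tdef_def vsuc_eq_iff by (intro sdef_intros assms[THEN tdef_shift2])

lemma vsuc_mono:
  fixes n :: "'a::ast"
  assumes "n \<in> naturals" "m \<in> elts n"
  shows "vsuc m \<in> elts (vsuc n)"
proof -
  have "\<forall>m\<in>elts n. vsuc m \<in> elts (vsuc n)"
  proof (rule natural_induct[OF assms(1), of "\<lambda>n. \<forall>m\<in>elts n. vsuc m \<in> elts (vsuc n)"])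
    show "sdef (\<lambda>e. \<forall>m\<in>elts (e 0). vsuc m \<in> elts (vsuc (e 0)))"
      by (intro sdef_intros)
  qed auto
  then show ?thesis
    using assms(2) by blast
qed

lemma natural_trichotomy:
  fixes n :: "'a::ast"
  assumes "m \<in> naturals" "n \<in> naturals"
  shows "m \<in> elts n \<or> m = n \<or> n \<in> elts m"
proof (rule natural_induct[OF assms(1), of "\<lambda>m. m \<in> elts n \<or> m = n \<or> n \<in> elts m"])
  show "sdef (\<lambda>e. e 0 \<in> elts n \<or> e 0 = n \<or> n \<in> elts (e 0))"
    by (intro sdef_intros)
  show "vempty \<in> elts n \<or> vempty = n \<or> n \<in> elts vempty"
    using vempty_in_vsuc[OF assms(2)] by auto
  fix m
  assume "m \<in> elts n \<or> m = n \<or> n \<in> elts m"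
  then show "vsuc m \<in> elts n \<or> vsuc m = n \<or> n \<in> elts (vsuc m)"
    using vsuc_mono[OF assms(2), of m] by auto
qed

lemma vsuc_inject:
  fixes m :: "'a::ast"
  assumes "vsuc m = vsuc n"
  shows "m = n"
proof -
  have "m \<in> insert n (elts n)" "n \<in> insert m (elts m)"
    using assms elts_vsuc[of m] elts_vsuc[of n] by auto
  then show ?thesis
    using no_two_cycle[of m n] by auto
qed

subsection \<open>Iteration along the natural numbers\<close>

lemma elts_upair [simp]:
  fixes x :: "'a::ast"
  shows "elts (upair x y) = {x, y}"
  by (auto simp: upair_def)

lemma upair_eq_iff:
  fixes x :: "'a::ast"
  shows "z = upair x y \<longleftrightarrow> (\<forall>w. w \<in> elts z \<longleftrightarrow> w = x \<or> w = y)"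
  unfolding vset_eq_iff[of z] by simp

lemma tdef_upair [sdef_intros]:
  assumes "tdef u" "tdef v"
  shows "tdef (\<lambda>e. upair (u e) (v e))"
  unfolding tdef_def upair_eq_iff by (intro sdef_intros assms[THEN tdef_shift2])

lemma tdef_opair [sdef_intros]:
  assumes "tdef u" "tdef v"
  shows "tdef (\<lambda>e. opair (u e) (v e))"
  unfolding opair_def by (intro sdef_intros assms)

lemma opair_inject [simp]:
  fixes x :: "'a::ast"
  shows "opair x y = opair x' y' \<longleftrightarrow> x = x' \<and> y = y'"
proof
  assume "opair x y = opair x' y'"
  then have "elts (opair x y) = elts (opair x' y')"
    by (rule arg_cong)
  then have "{upair x x, upair x y} = {upair x' x', upair x' y'}"
    unfolding opair_def elts_upair .
  moreover have "upair a b = upair c d \<longleftrightarrow> {a, b} = {c, d}" for a b c d :: 'a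
    unfolding vset_eq_iff[of "upair a b"] by (simp add: set_eq_iff)
  ultimately show "x = x' \<and> y = y'"
    by (auto simp: doubleton_eq_iff)
qed simp

lemma elts_class: "elts (x :: 'a::ast) \<in> classes"
proof -
  \<comment> \<open>Comprehension asks for an assignment of classes even when the formula mentions
    none, so some class must be known to exist; \<open>proper_semiset\<close> provides one.\<close>
  have "classes \<noteq> ({} :: 'a set set)"
    using proper_semiset by blast
  then obtain X where "X \<in> (classes :: 'a set set)" by blast
  then have "{y. sat (FMem 0 1) ((\<lambda>_. x)(0 := y)) (\<lambda>_. X)} \<in> (classes :: 'a set set)"
    by (intro comprehension)
  then show ?thesis
    by (simp add: elts_def)
qed

text \<open>The witnessing sequences of \<open>viter\<close> in a form accessible to set formulas:
  \<open>class_function\<close> refers to the collection of classes and \<open>app\<close> is a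
  description, so both are spelled out by membership of ordered pairs.\<close>

definition iter_set :: "('a \<Rightarrow> 'a) \<Rightarrow> 'a \<Rightarrow> 'a \<Rightarrow> 'a::ast \<Rightarrow> bool" where
  "iter_set g a n h \<longleftrightarrow> (\<forall>p\<in>elts h. \<exists>x\<in>elts (vsuc n). \<exists>y. p = opair x y)
     \<and> (\<forall>x\<in>elts (vsuc n). \<exists>y. opair x y \<in> elts h \<and> (\<forall>z. opair x z \<in> elts h \<longrightarrow> z = y))
     \<and> opair vempty a \<in> elts h
     \<and> (\<forall>i\<in>elts n. \<forall>y. opair i y \<in> elts h \<longrightarrow> opair (vsuc i) (g y) \<in> elts h)"

lemma class_function_elts:
  fixes h :: "'a::ast"
  shows "class_function (elts h) A UNIV \<longleftrightarrow> (\<forall>p\<in>elts h. \<exists>x\<in>A. \<exists>y. p = opair x y)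
     \<and> (\<forall>x\<in>A. \<exists>y. opair x y \<in> elts h \<and> (\<forall>z. opair x z \<in> elts h \<longrightarrow> z = y))"
  by (simp add: class_function_def Ex1_def elts_class)

lemma iter_set_iff:
  fixes n :: "'a::ast"
  shows "iter_set g a n h \<longleftrightarrow> class_function (elts h) (elts (vsuc n)) UNIV \<and> opair vempty a \<in> elts h
     \<and> (\<forall>i\<in>elts n. \<forall>y. opair i y \<in> elts h \<longrightarrow> opair (vsuc i) (g y) \<in> elts h)"
  unfolding iter_set_def class_function_elts conj_assoc by (rule refl)

lemma app_eq_iff:
  assumes "class_function F A B" "x \<in> A"
  shows "app F x = y \<longleftrightarrow> opair x y \<in> F"
proof -
  have "\<exists>!y. opair x y \<in> F"
    using assms by (simp add: class_function_def)
  then have "opair x (app F x) \<in> F" "\<And>z. opair x z \<in> F \<Longrightarrow> app F x = z"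
    unfolding app_def by (rule theI', rule the1_equality)
  then show ?thesis by blast
qed

lemma viter_eq:
  fixes n :: "'a::ast"
  assumes n: "n \<in> naturals"
  shows "viter g a n = (THE k. \<exists>h. iter_set g a n h \<and> opair n k \<in> elts h)"
proof -
  have "(class_function (elts h) (elts (vsuc n)) UNIV
     \<and> app (elts h) vempty = a
     \<and> (\<forall>i\<in>elts n. app (elts h) (vsuc i) = g (app (elts h) i))
     \<and> app (elts h) n = k) \<longleftrightarrow> iter_set g a n h \<and> opair n k \<in> elts h" for h k
  proof (cases "class_function (elts h) (elts (vsuc n)) UNIV")
    case cf: True
    have "app (elts h) (vsuc i) = g (app (elts h) i)
        \<longleftrightarrow> (\<forall>y. opair i y \<in> elts h \<longrightarrow> opair (vsuc i) (g y) \<in> elts h)" if "i \<in> elts n" for i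
    proof -
      have "i \<in> elts (vsuc n)" using that by simp
      note 1 = app_eq_iff[OF cf this] and 2 = app_eq_iff[OF cf vsuc_mono[OF n that]]
      show ?thesis
        unfolding 1[symmetric] 2[symmetric] by simp
    qed
    then have *: "(\<forall>i\<in>elts n. app (elts h) (vsuc i) = g (app (elts h) i)) \<longleftrightarrow>
        (\<forall>i\<in>elts n. \<forall>y. opair i y \<in> elts h \<longrightarrow> opair (vsuc i) (g y) \<in> elts h)"
      by (rule ball_cong[OF refl])
    have "n \<in> elts (vsuc n)" by simp
    note 1 = app_eq_iff[OF cf vempty_in_vsuc[OF n]] and 2 = app_eq_iff[OF cf this]
    show ?thesis
      unfolding iter_set_iff * 1 2 conj_assoc by (rule refl)
  next
    case False
    then show ?thesis unfolding iter_set_iff by simp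
  qed
  then show ?thesis
    unfolding viter_def by presburger
qed

lemma sdef_iter_set [sdef_intros]:
  assumes g: "tdef (\<lambda>e. g (e 0) (\<lambda>n. e (Suc n)))" and "tdef a" "tdef n" "tdef h"
  shows "sdef (\<lambda>e. iter_set (\<lambda>k. g k e) (a e) (n e) (h e))"
proof -
  have "tdef (\<lambda>e. g (e 0) (\<lambda>n. e (Suc (Suc n))))"
    unfolding tdef_def
    using sdef_rename[OF g[unfolded tdef_def], of "case_nat 0 (case_nat 1 (\<lambda>n. Suc (Suc (Suc n))))"] by simp
  then show ?thesis
    unfolding iter_set_def
    by (intro sdef_intros assms(2-4) assms(2-4)[THEN tdef_shift] assms(2-4)[THEN tdef_shift2]
        assms(2-4)[THEN tdef_shift3])
qed

lemma iter_set_unique: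
  assumes g: "tdef (\<lambda>e. g (e 0))" and n: "n \<in> naturals"
    and n': "n' \<in> naturals" and sub: "elts (vsuc n) \<subseteq> elts (vsuc n')"
    and h: "iter_set g a n h" "iter_set g a n' h'"
    and y: "opair n y \<in> elts h" "opair n y' \<in> elts h'"
  shows "y = y'"
proof -
  define P where "P i \<longleftrightarrow> i \<in> elts (vsuc n) \<longrightarrow>
    (\<forall>y y'. opair i y \<in> elts h \<longrightarrow> opair i y' \<in> elts h' \<longrightarrow> y = y')" for i
  have uniq: "z = w" if "iter_set g a m k" "x \<in> elts (vsuc m)" "opair x z \<in> elts k" "opair x w \<in> elts k"
    for m k x z w
    using app_eq_iff[OF _ that(2)] that(1,3,4) unfolding iter_set_iff by metis
  have total: "\<exists>z. opair x z \<in> elts k" if "iter_set g a m k" "x \<in> elts (vsuc m)" for m k x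
    using app_eq_iff[OF _ that(2)] that(1) unfolding iter_set_iff by metis
  have start: "opair vempty a \<in> elts k" if "iter_set g a m k" for m k
    using that unfolding iter_set_iff by simp
  have step: "opair (vsuc i) (g z) \<in> elts k"
    if "iter_set g a m k" "i \<in> elts m" "opair i z \<in> elts k" for m k i z
    using that unfolding iter_set_iff by simp
  have "P n"
  proof (rule natural_induct[OF n, of P])
    show "sdef (\<lambda>e. P (e 0))"
      unfolding P_def by (intro sdef_intros)
    show "P vempty"
      unfolding P_def
    proof (intro impI allI)
      fix y y'
      assume *: "vempty \<in> elts (vsuc n)" "opair vempty y \<in> elts h" "opair vempty y' \<in> elts h'"
      have "vempty \<in> elts (vsuc n')" by (rule subsetD[OF sub *(1)])
      then show "y = y'"
        using uniq[OF h(1) *(1,2) start[OF h(1)]] uniq[OF h(2) _ *(3) start[OF h(2)]] by simp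
    qed
    fix i
    assume i: "i \<in> naturals" and IH: "P i"
    show "P (vsuc i)"
      unfolding P_def
    proof (intro impI allI)
      fix y y'
      assume *: "vsuc i \<in> elts (vsuc n)" "opair (vsuc i) y \<in> elts h" "opair (vsuc i) y' \<in> elts h'"
      have dom': "vsuc i \<in> elts (vsuc n')" by (rule subsetD[OF sub *(1)])
      have lt: "i \<in> elts m" if "vsuc i \<in> elts (vsuc m)" "m \<in> naturals" for m
        using that natural_elts_subset[OF that(2), of "vsuc i"] by auto
      have in': "i \<in> elts (vsuc n')"
        using lt[OF dom' n'] by simp
      have "i \<in> elts (vsuc n)"
        using lt[OF *(1) n] by simp
      obtain z z' where z: "opair i z \<in> elts h" "opair i z' \<in> elts h'"
        using total[OF h(1) \<open>i \<in> elts (vsuc n)\<close>] total[OF h(2) in'] by blast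
      then have "z = z'" using IH \<open>i \<in> elts (vsuc n)\<close> unfolding P_def by blast
      then show "y = y'"
        using uniq[OF h(1) *(1,2) step[OF h(1) lt[OF *(1) n] z(1)]]
          uniq[OF h(2) dom' *(3) step[OF h(2) lt[OF dom' n'] z(2)]] by simp
    qed
  qed
  then show ?thesis
    using y by (simp add: P_def)
qed

text \<open>The recursion theorem of the theory. The length may be infinite, so existence needs
  internal induction; it is available because definability of \<open>g\<close> makes the existence
  statement a set formula.\<close>

lemma iter_set_exists:
  assumes g: "tdef (\<lambda>e. g (e 0))" and n: "n \<in> naturals"
  shows "\<exists>h. iter_set g a n h"
proof (rule natural_induct[OF n, of "\<lambda>n. \<exists>h. iter_set g a n h"])
  show "sdef (\<lambda>e. \<exists>h. iter_set g a (e 0) h)"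
    by (intro sdef_intros g)
  have "iter_set g a vempty (adjoin vempty (opair vempty a))"
    unfolding iter_set_def by simp
  then show "\<exists>h. iter_set g a vempty h" ..
  fix n
  assume n: "n \<in> naturals" and "\<exists>h. iter_set g a n h"
  then obtain h where h: "iter_set g a n h" by blast
  then have cf: "class_function (elts h) (elts (vsuc n)) UNIV"
    by (simp add: iter_set_iff)
  define k where "k = app (elts h) n"
  have k: "opair n k \<in> elts h"
    using app_eq_iff[OF cf, of n k] by (simp add: k_def)
  have uniq: "y = k" if "opair n y \<in> elts h" for y
    using app_eq_iff[OF cf, of n y] that by (simp add: k_def)
  have dom: "x = n \<or> x \<in> elts n" if "opair x y \<in> elts h" for x y
    using h that unfolding iter_set_def by fastforce
  \<comment> \<open>Regularity keeps \<open>vsuc n\<close> out of the old domain, so the added pair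
    cannot clash with an old value.\<close>
  have new: "vsuc n \<noteq> n" "vsuc n \<notin> elts n"
    using no_two_cycle[of n "vsuc n"] not_self_member[of "vsuc n"] elts_vsuc[of n] by force+
  have "iter_set g a (vsuc n) (adjoin h (opair (vsuc n) (g k)))"
    unfolding iter_set_def
  proof (intro conjI)
    show "\<forall>p\<in>elts (adjoin h (opair (vsuc n) (g k))). \<exists>x\<in>elts (vsuc (vsuc n)). \<exists>y. p = opair x y"
      using h unfolding iter_set_def by auto
    show "\<forall>x\<in>elts (vsuc (vsuc n)). \<exists>y. opair x y \<in> elts (adjoin h (opair (vsuc n) (g k)))
       \<and> (\<forall>z. opair x z \<in> elts (adjoin h (opair (vsuc n) (g k))) \<longrightarrow> z = y)"
    proof
      fix x
      assume "x \<in> elts (vsuc (vsuc n))"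
      then consider "x = vsuc n" | "x \<in> elts (vsuc n)" "x \<noteq> vsuc n"
        using new by auto
      then show "\<exists>y. opair x y \<in> elts (adjoin h (opair (vsuc n) (g k)))
       \<and> (\<forall>z. opair x z \<in> elts (adjoin h (opair (vsuc n) (g k))) \<longrightarrow> z = y)"
      proof cases
        case 1
        then show ?thesis using dom[of "vsuc n"] new by auto
      next
        case 2
        then show ?thesis
          using app_eq_iff[OF cf 2(1), symmetric] by auto
      qed
    qed
    show "opair vempty a \<in> elts (adjoin h (opair (vsuc n) (g k)))"
      using h unfolding iter_set_def by simp
    show "\<forall>i\<in>elts (vsuc n). \<forall>y. opair i y \<in> elts (adjoin h (opair (vsuc n) (g k))) \<longrightarrow>
        opair (vsuc i) (g y) \<in> elts (adjoin h (opair (vsuc n) (g k)))"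
    proof (intro ballI allI impI)
      fix i y
      assume i: "i \<in> elts (vsuc n)" and "opair i y \<in> elts (adjoin h (opair (vsuc n) (g k)))"
      then have y: "opair i y \<in> elts h"
        using new by auto
      show "opair (vsuc i) (g y) \<in> elts (adjoin h (opair (vsuc n) (g k)))"
      proof (cases "i = n")
        case True
        then show ?thesis using y uniq by simp
      next
        case False
        then show ?thesis using i y h by (simp add: iter_set_iff)
      qed
    qed
  qed
  then show "\<exists>h. iter_set g a (vsuc n) h" ..
qed

lemma viter_iff:
  assumes g: "tdef (\<lambda>e. g (e 0))" and n: "n \<in> naturals"
  shows "k = viter g a n \<longleftrightarrow> (\<exists>h. iter_set g a n h \<and> opair n k \<in> elts h)"
proof -
  obtain h where h: "iter_set g a n h"
    using iter_set_exists[OF g n] by blast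
  then have cf: "class_function (elts h) (elts (vsuc n)) UNIV"
    by (simp add: iter_set_iff)
  have "opair n (app (elts h) n) \<in> elts h"
    using app_eq_iff[OF cf, of n, THEN iffD1] by simp
  then have "\<exists>k h. iter_set g a n h \<and> opair n k \<in> elts h"
    using h by blast
  moreover have "k = k'" if "iter_set g a n h \<and> opair n k \<in> elts h" "iter_set g a n h' \<and> opair n k' \<in> elts h'"
    for k k' h h'
    using iter_set_unique[OF g n n subset_refl] that by blast
  ultimately have ex1: "\<exists>!k. \<exists>h. iter_set g a n h \<and> opair n k \<in> elts h"
    by (intro ex_ex1I) blast+
  show ?thesis
    unfolding viter_eq[OF n]
  proof
    assume "k = (THE k. \<exists>h. iter_set g a n h \<and> opair n k \<in> elts h)"
    then show "\<exists>h. iter_set g a n h \<and> opair n k \<in> elts h"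
      using theI'[OF ex1] by simp
  next
    assume "\<exists>h. iter_set g a n h \<and> opair n k \<in> elts h"
    then show "k = (THE k. \<exists>h. iter_set g a n h \<and> opair n k \<in> elts h)"
      by (rule the1_equality[OF ex1, symmetric])
  qed
qed

lemma viter_vempty:
  assumes g: "tdef (\<lambda>e. g (e 0))"
  shows "viter g a vempty = a"
proof -
  have "iter_set g a vempty (adjoin vempty (opair vempty a))"
    unfolding iter_set_def by simp
  then show ?thesis
    using viter_iff[OF g vempty_natural, of a a] by auto
qed

lemma viter_vsuc:
  assumes g: "tdef (\<lambda>e. g (e 0))" and n: "n \<in> naturals"
  shows "viter g a (vsuc n) = g (viter g a n)"
proof -
  obtain h where h: "iter_set g a n h" "opair n (viter g a n) \<in> elts h"
    using viter_iff[OF g n] by blast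
  obtain h' where h': "iter_set g a (vsuc n) h'"
    using iter_set_exists[OF g vsuc_natural[OF n]] by blast
  then have cf: "class_function (elts h') (elts (vsuc (vsuc n))) UNIV"
    by (simp add: iter_set_iff)
  have y: "opair n (app (elts h') n) \<in> elts h'"
    using app_eq_iff[OF cf, of n, THEN iffD1] by simp
  have "elts (vsuc n) \<subseteq> elts (vsuc (vsuc n))" by auto
  from iter_set_unique[OF g n vsuc_natural[OF n] this h(1) h' h(2) y]
  have "viter g a n = app (elts h') n" .
  then have "opair (vsuc n) (g (viter g a n)) \<in> elts h'"
    using h' y by (simp add: iter_set_iff)
  then have "g (viter g a n) = viter g a (vsuc n)"
    using viter_iff[OF g vsuc_natural[OF n]] h' by blast
  then show ?thesis by simp
qed

text \<open>Definability survives recursion, which is how arithmetic becomes expressible by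
  membership alone. The count must be natural in every environment, since \<open>viter\<close> is
  characterised only for such counts.\<close>

lemma tdef_viter:
  assumes g: "tdef (\<lambda>e. g (e 0) (\<lambda>n. e (Suc n)))" and a: "tdef a" and n: "tdef n"
    and nat: "\<And>e. n e \<in> naturals"
  shows "tdef (\<lambda>e. viter (\<lambda>k. g k e) (a e) (n e))"
proof -
  have eq: "k = viter (\<lambda>k. g k e) (a e) (n e)
      \<longleftrightarrow> (\<exists>h. iter_set (\<lambda>k. g k e) (a e) (n e) h \<and> opair (n e) k \<in> elts h)" for k e
    by (rule viter_iff[OF tdef_fix_params[OF g] nat])
  have g2: "tdef (\<lambda>e. g (e 0) (\<lambda>n. e (Suc (Suc (Suc n)))))"
    unfolding tdef_def
    using sdef_rename[OF g[unfolded tdef_def],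
        of "case_nat 0 (case_nat 1 (\<lambda>n. Suc (Suc (Suc (Suc n)))))"] by simp
  show ?thesis
    unfolding tdef_def eq
    by (intro sdef_intros g2 a[THEN tdef_shift2] n[THEN tdef_shift2])
qed

subsection \<open>The ordered semiring of natural numbers\<close>

text \<open>\<open>toN\<close> is total and onto, so that a quantifier over natural numbers is a quantifier over all
  sets; sets that are not natural numbers are sent to \<open>0\<close>.\<close>

definition toN :: "'a::ast \<Rightarrow> 'a anat" where
  "toN x = (if x \<in> naturals then Abs_anat x else 0)"

definition ndef :: "((nat \<Rightarrow> 'a) \<Rightarrow> 'a::ast anat) \<Rightarrow> bool" where
  "ndef u \<longleftrightarrow> tdef (\<lambda>e. Rep_anat (u e))"

definition asuc :: "'a::ast anat \<Rightarrow> 'a anat" where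
  "asuc n = Abs_anat (vsuc (Rep_anat n))"

lemma Rep_anat_0: "Rep_anat 0 = vempty"
  by (simp add: zero_anat_def Abs_anat_inverse vempty_natural)

lemma Rep_anat_asuc: "Rep_anat (asuc n) = vsuc (Rep_anat n)"
  using Rep_anat[of n] by (simp add: asuc_def Abs_anat_inverse vsuc_natural)

lemma Rep_anat_natural: "Rep_anat n \<in> naturals"
  by (rule Rep_anat)

lemma toN_Rep [simp]: "toN (Rep_anat n) = n"
  by (simp add: toN_def Rep_anat_natural Rep_anat_inverse)

lemma Rep_toN: "Rep_anat (toN x) = (if x \<in> naturals then x else vempty)"
  by (simp add: toN_def Rep_anat_0 Abs_anat_inverse)

lemma tdef_Rep_anat [sdef_intros]: "ndef u \<Longrightarrow> tdef (\<lambda>e. Rep_anat (u e))"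
  by (simp add: ndef_def)

lemma ndef_const [sdef_intros]: "ndef (\<lambda>e. c)"
  unfolding ndef_def by (rule tdef_const)

lemma ndef_shift: "ndef u \<Longrightarrow> ndef (\<lambda>e. u (\<lambda>n. e (Suc n)))"
  unfolding ndef_def by (rule tdef_shift)

lemma ndef_toN [sdef_intros]:
  assumes "tdef u"
  shows "ndef (\<lambda>e. toN (u e))"
proof -
  have eq: "z = Rep_anat (toN x) \<longleftrightarrow> (x \<in> naturals \<and> z = x) \<or> (x \<notin> naturals \<and> z = vempty)" for z x
    by (auto simp: Rep_toN)
  show ?thesis
    unfolding ndef_def tdef_def eq
    by (intro sdef_intros sdef_naturals tdef_shift[OF assms])
qed

lemma sdef_all_anat [sdef_intros]:
  assumes "sdef (\<lambda>e. P (toN (e 0)) (\<lambda>n. e (Suc n)))"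
  shows "sdef (\<lambda>e. \<forall>n. P n e)"
proof -
  have eq: "(\<forall>n. Q n) \<longleftrightarrow> (\<forall>x. Q (toN x))" for Q :: "'a anat \<Rightarrow> bool"
    by (metis toN_Rep)
  show ?thesis
    unfolding eq by (intro sdef_all assms)
qed

lemma sdef_ex_anat [sdef_intros]:
  assumes "sdef (\<lambda>e. P (toN (e 0)) (\<lambda>n. e (Suc n)))"
  shows "sdef (\<lambda>e. \<exists>n. P n e)"
proof -
  have eq: "(\<exists>n. Q n) \<longleftrightarrow> (\<exists>x. Q (toN x))" for Q :: "'a anat \<Rightarrow> bool"
    by (metis toN_Rep)
  show ?thesis
    unfolding eq by (intro sdef_ex assms)
qed

lemma sdef_eq_anat [sdef_intros]:
  assumes "ndef u" "ndef v"
  shows "sdef (\<lambda>e. u e = v e)"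
  unfolding Rep_anat_inject[symmetric] by (intro sdef_intros assms)

lemma sdef_less_anat [sdef_intros]:
  assumes "ndef u" "ndef v"
  shows "sdef (\<lambda>e. u e < v e)"
  unfolding less_anat_def by (intro sdef_intros assms)

lemma sdef_le_anat [sdef_intros]:
  assumes "ndef u" "ndef v"
  shows "sdef (\<lambda>e. u e \<le> v e)"
  unfolding less_eq_anat_def by (intro sdef_intros assms)

lemma ndef_asuc [sdef_intros]:
  assumes "ndef u"
  shows "ndef (\<lambda>e. asuc (u e))"
  unfolding ndef_def Rep_anat_asuc by (intro sdef_intros assms)

lemma anat_induct:
  assumes "sdef (\<lambda>e. P (toN (e 0)))" "P 0" and step: "\<And>n. P n \<Longrightarrow> P (asuc n)"
  shows "P n"
proof -
  have "P (toN (Rep_anat n))"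
  proof (rule natural_induct[OF Rep_anat_natural, of "\<lambda>x. P (toN x)"])
    show "sdef (\<lambda>e. P (toN (e 0)))" by fact
    show "P (toN vempty)"
      using assms(2) by (simp add: toN_def vempty_natural zero_anat_def)
    fix x
    assume x: "x \<in> naturals" "P (toN x)"
    have "toN (vsuc x) = asuc (toN x)"
      using x(1) by (simp add: Rep_anat_inject[symmetric] Rep_anat_asuc Rep_toN vsuc_natural)
    then show "P (toN (vsuc x))"
      using step[OF x(2)] by simp
  qed
  then show ?thesis by simp
qed

lemma asuc_inject [simp]: "asuc m = asuc n \<longleftrightarrow> m = n"
  using vsuc_inject[of "Rep_anat m" "Rep_anat n"]
  by (auto simp: Rep_anat_inject[symmetric] Rep_anat_asuc)

lemma asuc_neq_0 [simp]: "asuc n \<noteq> 0" "0 \<noteq> asuc n"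
proof -
  have "elts (Rep_anat (asuc n)) \<noteq> elts (Rep_anat 0)"
    by (simp add: Rep_anat_asuc Rep_anat_0)
  then show "asuc n \<noteq> 0" "0 \<noteq> asuc n" by auto
qed

lemma one_anat_eq: "1 = asuc 0"
  by (simp add: one_anat_def asuc_def Rep_anat_0)

section \<open>Addition and multiplication\<close>

lemma vadd_vempty: "vadd m vempty = (m :: 'a::ast)"
  unfolding vadd_def by (intro viter_vempty sdef_intros)

lemma vadd_vsuc: "n \<in> naturals \<Longrightarrow> vadd m (vsuc n) = vsuc (vadd m (n :: 'a::ast))"
  unfolding vadd_def by (intro viter_vsuc sdef_intros)

lemma tdef_vadd [sdef_intros]:
  assumes "tdef m" "ndef n"
  shows "tdef (\<lambda>e. vadd (m e) (Rep_anat (n e)))"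
  unfolding vadd_def by (intro tdef_viter sdef_intros assms Rep_anat_natural)

lemma vadd_natural: "vadd (Rep_anat m) (Rep_anat n) \<in> naturals"
proof (rule anat_induct[of "\<lambda>n. vadd (Rep_anat m) (Rep_anat n) \<in> naturals"])
  show "sdef (\<lambda>e. vadd (Rep_anat m) (Rep_anat (toN (e 0))) \<in> naturals)"
    by (intro sdef_naturals sdef_intros)
qed (simp_all add: Rep_anat_0 Rep_anat_asuc Rep_anat_natural vadd_vempty vadd_vsuc vsuc_natural)

lemma Rep_anat_plus: "Rep_anat (m + n) = vadd (Rep_anat m) (Rep_anat n)"
  by (simp add: plus_anat_def Abs_anat_inverse vadd_natural)

lemma ndef_plus [sdef_intros]:
  assumes "ndef u" "ndef v"
  shows "ndef (\<lambda>e. u e + v e)"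
  unfolding ndef_def Rep_anat_plus by (intro sdef_intros assms)

lemma vmult_vempty: "vmult (Rep_anat m) vempty = vempty"
  unfolding vmult_def by (intro viter_vempty sdef_intros)

lemma vmult_vsuc:
  assumes "n \<in> naturals"
  shows "vmult (Rep_anat m) (vsuc n) = vadd (vmult (Rep_anat m) n) (Rep_anat m)"
  unfolding vmult_def by (intro viter_vsuc sdef_intros assms)

lemma tdef_vmult [sdef_intros]:
  assumes "ndef m" "ndef n"
  shows "tdef (\<lambda>e. vmult (Rep_anat (m e)) (Rep_anat (n e)))"
  unfolding vmult_def by (intro tdef_viter sdef_intros assms Rep_anat_natural ndef_shift[OF assms(1)])

lemma vmult_natural: "vmult (Rep_anat m) (Rep_anat n) \<in> naturals"
proof (rule anat_induct[of "\<lambda>n. vmult (Rep_anat m) (Rep_anat n) \<in> naturals"])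
  show "sdef (\<lambda>e. vmult (Rep_anat m) (Rep_anat (toN (e 0))) \<in> naturals)"
    by (intro sdef_naturals sdef_intros)
  fix n
  assume "vmult (Rep_anat m) (Rep_anat n) \<in> naturals"
  then have "vadd (vmult (Rep_anat m) (Rep_anat n)) (Rep_anat m) \<in> naturals"
    using vadd_natural[of "Abs_anat (vmult (Rep_anat m) (Rep_anat n))" m]
    by (simp add: Abs_anat_inverse)
  then show "vmult (Rep_anat m) (Rep_anat (asuc n)) \<in> naturals"
    by (simp add: Rep_anat_asuc vmult_vsuc Rep_anat_natural)
qed (simp add: Rep_anat_0 vmult_vempty vempty_natural)

lemma Rep_anat_times: "Rep_anat (m * n) = vmult (Rep_anat m) (Rep_anat n)"
  by (simp add: times_anat_def Abs_anat_inverse vmult_natural)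

lemma ndef_times [sdef_intros]:
  assumes "ndef u" "ndef v"
  shows "ndef (\<lambda>e. u e * v e)"
  unfolding ndef_def Rep_anat_times by (intro sdef_intros assms)

lemma anat_add_0: "m + 0 = (m :: 'a::ast anat)"
  by (simp add: Rep_anat_inject[symmetric] Rep_anat_plus Rep_anat_0 vadd_vempty)

lemma anat_add_asuc: "m + asuc n = asuc (m + n)"
  by (simp add: Rep_anat_inject[symmetric] Rep_anat_plus Rep_anat_asuc vadd_vsuc Rep_anat_natural)

lemma anat_mult_0: "m * 0 = (0 :: 'a::ast anat)"
  by (simp add: Rep_anat_inject[symmetric] Rep_anat_times Rep_anat_0 vmult_vempty)

lemma anat_mult_asuc: "m * asuc n = m * n + m"
  by (simp add: Rep_anat_inject[symmetric] Rep_anat_plus Rep_anat_times Rep_anat_asuc vmult_vsuc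
      Rep_anat_natural)

lemma anat_0_add: "0 + n = (n :: 'a::ast anat)"
proof (rule anat_induct[of "\<lambda>n. 0 + n = n"])
  show "sdef (\<lambda>e. 0 + toN (e 0) = toN (e 0))" by (intro sdef_intros)
qed (simp_all add: anat_add_0 anat_add_asuc)

lemma anat_asuc_add: "asuc m + n = asuc (m + n)"
proof (rule anat_induct[of "\<lambda>n. asuc m + n = asuc (m + n)"])
  show "sdef (\<lambda>e. asuc m + toN (e 0) = asuc (m + toN (e 0)))" by (intro sdef_intros)
qed (simp_all add: anat_add_0 anat_add_asuc)

lemma anat_add_commute: "m + n = n + (m :: 'a::ast anat)"
proof (rule anat_induct[of "\<lambda>n. m + n = n + m"])
  show "sdef (\<lambda>e. m + toN (e 0) = toN (e 0) + m)" by (intro sdef_intros)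
qed (simp_all add: anat_add_0 anat_add_asuc anat_0_add anat_asuc_add)

lemma anat_add_assoc: "(m + n) + k = m + (n + k :: 'a::ast anat)"
proof (rule anat_induct[of "\<lambda>k. (m + n) + k = m + (n + k)"])
  show "sdef (\<lambda>e. (m + n) + toN (e 0) = m + (n + toN (e 0)))" by (intro sdef_intros)
qed (simp_all add: anat_add_0 anat_add_asuc)

lemma anat_add_cancel: "m + k = n + k \<longleftrightarrow> m = (n :: 'a::ast anat)"
proof (rule anat_induct[of "\<lambda>k. m + k = n + k \<longleftrightarrow> m = n"])
  show "sdef (\<lambda>e. m + toN (e 0) = n + toN (e 0) \<longleftrightarrow> m = n)" by (intro sdef_intros)
qed (simp_all add: anat_add_0 anat_add_asuc)

lemma anat_0_mult: "0 * n = (0 :: 'a::ast anat)"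
proof (rule anat_induct[of "\<lambda>n. 0 * n = 0"])
  show "sdef (\<lambda>e. 0 * toN (e 0) = 0)" by (intro sdef_intros)
qed (simp_all add: anat_mult_0 anat_mult_asuc anat_add_0)

lemma anat_asuc_mult: "asuc m * n = m * n + n"
proof (rule anat_induct[of "\<lambda>n. asuc m * n = m * n + n"])
  show "sdef (\<lambda>e. asuc m * toN (e 0) = m * toN (e 0) + toN (e 0))" by (intro sdef_intros)
  fix n
  assume "asuc m * n = m * n + n"
  moreover have "(m * n + n) + m = (m * n + m) + n"
    unfolding anat_add_assoc anat_add_commute[of n m] ..
  ultimately show "asuc m * asuc n = m * asuc n + asuc n"
    by (simp add: anat_mult_asuc anat_add_asuc)
qed (simp_all add: anat_mult_0 anat_add_0)

lemma anat_mult_commute: "m * n = n * (m :: 'a::ast anat)"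
proof (rule anat_induct[of "\<lambda>n. m * n = n * m"])
  show "sdef (\<lambda>e. m * toN (e 0) = toN (e 0) * m)" by (intro sdef_intros)
qed (simp_all add: anat_mult_0 anat_mult_asuc anat_0_mult anat_asuc_mult)

lemma anat_distrib: "m * (n + k) = m * n + m * (k :: 'a::ast anat)"
proof (rule anat_induct[of "\<lambda>k. m * (n + k) = m * n + m * k"])
  show "sdef (\<lambda>e. m * (n + toN (e 0)) = m * n + m * toN (e 0))" by (intro sdef_intros)
qed (simp_all add: anat_mult_0 anat_mult_asuc anat_add_0 anat_add_asuc anat_add_assoc)

lemma anat_mult_assoc: "(m * n) * k = m * (n * k :: 'a::ast anat)"
proof (rule anat_induct[of "\<lambda>k. (m * n) * k = m * (n * k)"])
  show "sdef (\<lambda>e. (m * n) * toN (e 0) = m * (n * toN (e 0)))" by (intro sdef_intros)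
qed (simp_all add: anat_mult_0 anat_mult_asuc anat_distrib)

lemma anat_exhaust: 
  obtains "n = 0" | m where "n = asuc m"
proof -
  have "n = 0 \<or> (\<exists>m. n = asuc m)"
  proof (rule anat_induct[of "\<lambda>n. n = 0 \<or> (\<exists>m. n = asuc m)"])
    show "sdef (\<lambda>e. toN (e 0) = 0 \<or> (\<exists>m. toN (e 0) = asuc m))" by (intro sdef_intros)
  qed auto
  then show ?thesis using that by blast
qed

section \<open>The order of the natural numbers\<close>

lemma anat_less_asuc: "m < asuc n \<longleftrightarrow> m \<le> n"
  by (auto simp: less_anat_def less_eq_anat_def Rep_anat_asuc vmem_iff Rep_anat_inject)

lemma anat_not_less_0: "\<not> m < (0 :: 'a::ast anat)"
  by (simp add: less_anat_def vmem_iff Rep_anat_0)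

lemma anat_le_add: "m \<le> m + (k :: 'a::ast anat)"
proof (rule anat_induct[of "\<lambda>k. m \<le> m + k"])
  show "sdef (\<lambda>e. m \<le> m + toN (e 0))" by (intro sdef_intros)
  fix n assume "m \<le> m + n"
  then show "m \<le> m + asuc n"
    by (simp add: anat_add_asuc anat_less_asuc less_eq_anat_def[of m "asuc (m + n)"])
qed (simp add: anat_add_0 less_eq_anat_def)

text \<open>Translates the order, defined by membership, into addition; monotonicity laws then
  reduce to associativity and cancellation.\<close>

lemma anat_le_iff_add: "m \<le> n \<longleftrightarrow> (\<exists>k. n = m + (k :: 'a::ast anat))"
proof
  show "m \<le> n \<Longrightarrow> \<exists>k. n = m + k"
  proof -
    have "m \<le> n \<longrightarrow> (\<exists>k. n = m + k)"
    proof (rule anat_induct[of "\<lambda>n. m \<le> n \<longrightarrow> (\<exists>k. n = m + k)"])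
      show "sdef (\<lambda>e. m \<le> toN (e 0) \<longrightarrow> (\<exists>k. toN (e 0) = m + k))" by (intro sdef_intros)
      show "m \<le> 0 \<longrightarrow> (\<exists>k. 0 = m + k)"
        using anat_add_0[of m] by (auto simp: less_eq_anat_def anat_not_less_0)
      fix n
      assume "m \<le> n \<longrightarrow> (\<exists>k. n = m + k)"
      then show "m \<le> asuc n \<longrightarrow> (\<exists>k. asuc n = m + k)"
        by (metis less_eq_anat_def anat_less_asuc anat_add_0 anat_add_asuc)
    qed
    then show "m \<le> n \<Longrightarrow> \<exists>k. n = m + k" by simp
  qed
qed (use anat_le_add in auto)

lemma anat_less_iff_add: "m < n \<longleftrightarrow> (\<exists>k. n = m + asuc (k :: 'a::ast anat))"
proof (cases n rule: anat_exhaust)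
  case 1
  then show ?thesis by (simp add: anat_not_less_0 anat_add_asuc)
next
  case (2 n')
  then show ?thesis by (simp add: anat_less_asuc anat_le_iff_add anat_add_asuc)
qed

lemma anat_less_irrefl: "\<not> n < (n :: 'a::ast anat)"
  by (simp add: less_anat_def vmem_iff not_self_member)

lemma anat_less_trans: "k < m \<Longrightarrow> m < n \<Longrightarrow> k < (n :: 'a::ast anat)"
  using natural_elts_subset[OF Rep_anat_natural, of "Rep_anat m" n]
  by (auto simp: less_anat_def vmem_iff)

lemma anat_linear: "m < n \<or> m = n \<or> n < (m :: 'a::ast anat)"
  using natural_trichotomy[OF Rep_anat_natural Rep_anat_natural, of m n]
  by (auto simp: less_anat_def vmem_iff Rep_anat_inject)

lemma anat_add_cancel_left: "k + m = k + n \<longleftrightarrow> m = (n :: 'a::ast anat)"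
  by (simp add: anat_add_commute[of k] anat_add_cancel)

text \<open>Truncated subtraction is introduced because the class \<open>linordered_semidom\<close>
  includes such an operation among its laws.\<close>

instantiation anat :: (ast) minus
begin

definition minus_anat :: "'a anat \<Rightarrow> 'a anat \<Rightarrow> 'a anat" where
  "minus_anat m n = (if n \<le> m then THE k. m = n + k else 0)"

instance ..

end

lemma anat_add_diff: "(m + k) - m = (k :: 'a::ast anat)"
proof -
  have "(THE j. m + k = m + j) = k"
    by (rule the_equality) (simp_all add: anat_add_cancel_left)
  then show ?thesis
    by (simp add: minus_anat_def anat_le_add)
qed

lemma anat_diff_eq_0: "\<not> n \<le> m \<Longrightarrow> m - n = (0 :: 'a::ast anat)"
  by (simp add: minus_anat_def)

instance anat :: (ast) linordered_semidom
proof
  fix a b c :: "'a anat"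
  show "a + b + c = a + (b + c)" by (rule anat_add_assoc)
  show "a + b = b + a" by (rule anat_add_commute)
  show "0 + a = a" by (rule anat_0_add)
  show "a + b - a = b" by (rule anat_add_diff)
  show less_le: "a < b \<longleftrightarrow> a \<le> b \<and> \<not> b \<le> a" for a b :: "'a anat"
    using anat_less_irrefl[of a] anat_less_trans[of a b a] unfolding less_eq_anat_def by auto
  show refl: "a \<le> a" for a :: "'a anat" by (simp add: less_eq_anat_def)
  show trans: "a \<le> b \<Longrightarrow> b \<le> c \<Longrightarrow> a \<le> c" for a b c :: "'a anat"
    using anat_less_trans[of a b c] unfolding less_eq_anat_def by auto
  show "a \<le> b \<Longrightarrow> b \<le> a \<Longrightarrow> a = b"
    using anat_less_irrefl[of a] anat_less_trans[of a b a] unfolding less_eq_anat_def by auto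
  show lin: "a \<le> b \<or> b \<le> a" for a b :: "'a anat"
    using anat_linear[of a b] unfolding less_eq_anat_def by auto
  show add_mono: "a \<le> b \<Longrightarrow> c + a \<le> c + b" for a b c :: "'a anat"
    unfolding anat_le_iff_add anat_add_assoc anat_add_cancel_left .
  have le_cancel: "c + a \<le> c + b \<longleftrightarrow> a \<le> b" for a b c :: "'a anat"
    unfolding anat_le_iff_add anat_add_assoc anat_add_cancel_left ..
  show "a - b - c = a - (b + c)"
  proof (cases "b \<le> a")
    case True
    then obtain k where k: "a = b + k" unfolding anat_le_iff_add by blast
    show ?thesis
    proof (cases "c \<le> k")
      case True
      then obtain j where "k = c + j" unfolding anat_le_iff_add by blast
      then show ?thesis
        unfolding k using anat_add_diff[of "b + c" j] by (simp add: anat_add_diff anat_add_assoc)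
    next
      case False
      then show ?thesis
        unfolding k anat_add_diff by (simp add: anat_diff_eq_0 le_cancel)
    qed
  next
    case False
    have "\<not> b + c \<le> a"
      using False trans[OF anat_le_add[of b c], of a] by auto
    moreover have "0 - c = (0 :: 'a anat)"
    proof (cases "c = 0")
      case True
      then show ?thesis using anat_add_diff[of 0 0] by (simp add: anat_0_add)
    next
      case False
      then show ?thesis
        by (intro anat_diff_eq_0) (auto simp: less_eq_anat_def anat_not_less_0)
    qed
    ultimately show ?thesis
      using False by (simp add: anat_diff_eq_0)
  qed
  show "a * b * c = a * (b * c)" by (rule anat_mult_assoc)
  show "a * b = b * a" by (rule anat_mult_commute)
  show "1 * a = a" by (simp add: one_anat_eq anat_asuc_mult anat_0_mult anat_0_add)
  show "(a + b) * c = a * c + b * c"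
    using anat_distrib[of c a b] by (simp add: anat_mult_commute)
  show "a * (b + c) = a * b + a * c" by (rule anat_distrib)
  show "0 \<noteq> (1 :: 'a anat)" by (simp add: one_anat_eq)
  show "(0 :: 'a anat) < 1" by (simp add: one_anat_eq anat_less_asuc less_eq_anat_def)
  show "0 * a = 0" by (rule anat_0_mult)
  show "a * 0 = 0" by (rule anat_mult_0)
  \<comment> \<open>Nonzero numbers are successors, and a product of two successors is again a
    successor.\<close>
  have nzd: "a * b \<noteq> 0" if "a \<noteq> 0" "b \<noteq> 0" for a b :: "'a anat"
    using that by (cases a rule: anat_exhaust; cases b rule: anat_exhaust)
      (simp_all add: anat_mult_asuc anat_add_asuc)
  show "a \<noteq> 0 \<Longrightarrow> b \<noteq> 0 \<Longrightarrow> a * b \<noteq> 0" by (rule nzd)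
  show mult_mono: "c * a < c * b" if "a < b" "0 < c" for a b c :: "'a anat"
  proof -
    obtain k where k: "b = a + asuc k"
      using \<open>a < b\<close> unfolding anat_less_iff_add by blast
    have "c \<noteq> 0"
      using \<open>0 < c\<close> anat_less_irrefl[of c] by auto
    then have "c * asuc k \<noteq> 0"
      by (rule nzd) simp
    then obtain j where j: "c * asuc k = asuc j"
      by (cases "c * asuc k" rule: anat_exhaust) auto
    then show ?thesis
      unfolding k anat_distrib anat_less_iff_add j by blast
  qed
  show "a * (b - c) = a * b - a * c"
  proof (cases "c \<le> b")
    case True
    then obtain k where "b = c + k" unfolding anat_le_iff_add by blast
    then show ?thesis
      by (simp add: anat_distrib anat_add_diff)
  next
    case False
    then have bc: "b < c" using lin[of b c] less_le[of b c] by auto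
    show ?thesis
    proof (cases "a = 0")
      case True
      then show ?thesis
        using anat_add_diff[of 0 0] by (simp add: anat_0_mult anat_0_add)
    next
      case a: False
      then have "0 < a"
        using anat_linear[of 0 a] anat_not_less_0[of a] by auto
      then have "\<not> a * c \<le> a * b"
        using mult_mono[OF bc, of a] less_le[of "a * b" "a * c"] by auto
      then show ?thesis
        using False by (simp add: anat_diff_eq_0 anat_mult_0)
    qed
  qed
  show "a - b + b = a" if le: "b \<le> a"
  proof -
    obtain k where "a = b + k"
      using le unfolding anat_le_iff_add by blast
    then show ?thesis
      using anat_add_commute[of k b] by (simp add: anat_add_diff)
  qed
qed

lemma asuc_eq: "asuc n = n + 1"
  by (simp add: one_anat_eq anat_add_asuc)

lemma anat_zero_le [simp]: "0 \<le> (n :: 'a::ast anat)"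
  using anat_not_less_0 not_less by blast

lemma anat_pos_iff: "0 < n \<longleftrightarrow> n \<noteq> (0 :: 'a::ast anat)"
  unfolding order.strict_iff_order by auto

text \<open>Regularity read as a least number principle. Definability is essential: the infinite
  numbers have no least member.\<close>

lemma anat_least:
  assumes "sdef (\<lambda>e. P (toN (e 0)))" "P n"
  obtains m where "P m" "\<And>k. k < m \<Longrightarrow> \<not> P k"
proof -
  have "sdef (\<lambda>e. e 0 \<in> naturals \<and> P (toN (e 0)))"
    by (intro sdef_intros sdef_naturals assms(1))
  moreover have "Rep_anat n \<in> naturals \<and> P (toN (Rep_anat n))"
    using assms(2) by (simp add: Rep_anat_natural)
  ultimately obtain y where y: "y \<in> naturals" "P (toN y)"
      "\<And>z. z \<in> elts y \<Longrightarrow> \<not> (z \<in> naturals \<and> P (toN z))"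
    using set_minimal[of "\<lambda>x. x \<in> naturals \<and> P (toN x)" "Rep_anat n"] by blast
  show ?thesis
  proof
    show "P (toN y)" by fact
    fix k
    assume "k < toN y"
    then have "Rep_anat k \<in> elts y"
      using y(1) by (simp add: less_anat_def vmem_iff Rep_toN)
    then show "\<not> P k"
      using y(3)[of "Rep_anat k"] by (simp add: Rep_anat_natural)
  qed
qed

subsection \<open>Finite natural numbers\<close>

lemma zero_in_FN: "0 \<in> FN"
  by (auto simp: FN_def finite_naturals_def finite_class_def Rep_anat_0 vempty_natural
      intro: image_eqI[of _ _ vempty])

lemma FN_downward:
  assumes "n \<in> FN" "m \<le> n"
  shows "m \<in> FN"
proof -
  have "elts (Rep_anat m) \<subseteq> elts (Rep_anat n)"
    using assms(2) natural_elts_subset[OF Rep_anat_natural, of "Rep_anat m" n]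
    by (auto simp: less_eq_anat_def less_anat_def vmem_iff)
  then show ?thesis
    using assms(1) by (auto simp: FN_def finite_naturals_def finite_class_def Rep_anat_natural)
qed

lemma finite_class_insert:
  fixes X :: "'a::ast set"
  assumes "finite_class X"
  shows "finite_class (insert x X)"
  unfolding finite_class_def
proof (intro ballI impI)
  fix Y :: "'a set"
  assume Y: "Y \<in> classes" "Y \<subseteq> insert x X"
  \<comment> \<open>The formula says that \<open>y\<close> is in \<open>Y\<close> and differs from
    \<open>x\<close>, with \<open>x\<close> held by set variable 1 and \<open>Y\<close> by every
    class variable.\<close>
  have "{y. sat (FConj (FIn 0 0) (FNeg (FEq 0 1))) ((\<lambda>_. x)(0 := y)) (\<lambda>_. Y)} \<in> classes"
    by (rule comprehension) (rule Y(1))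
  then have "Y - {x} \<in> classes"
    by (simp add: set_diff_eq)
  then have "Y - {x} \<in> range elts"
    using assms Y(2) by (auto simp: finite_class_def)
  then obtain z where z: "Y - {x} = elts z" by blast
  show "Y \<in> range elts"
  proof (cases "x \<in> Y")
    case True
    then have "Y = elts (adjoin z x)" using z by auto
    then show ?thesis by blast
  next
    case False
    then show ?thesis using z by auto
  qed
qed

lemma FN_add_1: "n \<in> FN \<Longrightarrow> n + 1 \<in> FN"
  by (simp add: asuc_eq[symmetric] FN_def finite_naturals_def Rep_anat_asuc vsuc_natural
      finite_class_insert)

lemma FN_less: "i \<in> FN \<Longrightarrow> k \<notin> FN \<Longrightarrow> i < k"
  using FN_downward not_less by blast

subsection \<open>The ring of differences of an ordered semiring\<close>

text \<open>Formal differences, that is, the integers over a cancellative semiring. They supply the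
  negatives that \<open>anat\<close> lacks, since a fraction field is formed over an integral
  domain.\<close>

definition diff_rel :: "'a::linordered_semidom \<times> 'a \<Rightarrow> 'a \<times> 'a \<Rightarrow> bool" where
  "diff_rel = (\<lambda>(x, y) (u, v). x + v = u + y)"

lemma diff_rel_iff [simp]: "diff_rel (x, y) (u, v) \<longleftrightarrow> x + v = u + y"
  by (simp add: diff_rel_def)

quotient_type (overloaded) 'a differences = "'a::linordered_semidom \<times> 'a" / diff_rel
  morphisms Rep_Differences Abs_Differences
proof (rule equivpI)
  show "reflp (diff_rel :: 'a \<times> 'a \<Rightarrow> _)" by (auto simp: reflp_def)
  show "symp (diff_rel :: 'a \<times> 'a \<Rightarrow> _)" by (auto simp: symp_def)
  show "transp (diff_rel :: 'a \<times> 'a \<Rightarrow> _)"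
  proof (rule transpI, clarsimp)
    fix a b c d e f :: 'a
    assume "a + d = c + b" "c + f = e + d"
    then have "(a + d) + (c + f) = (c + b) + (e + d)" by simp
    then have "(a + f) + (c + d) = (e + b) + (c + d)" by (simp only: add_ac)
    then show "a + f = e + b" by simp
  qed
qed

instantiation differences :: (linordered_semidom) comm_ring_1
begin

lift_definition zero_differences :: "'a differences" is "(0, 0)" .

lift_definition one_differences :: "'a differences" is "(1, 0)" .

lift_definition plus_differences :: "'a differences \<Rightarrow> 'a differences \<Rightarrow> 'a differences"
  is "\<lambda>(x, y) (u, v). (x + u, y + v)"
proof clarsimp
  fix a b c d e f g h :: 'a
  assume "a + d = c + b" "e + h = g + f"
  then have "(a + d) + (e + h) = (c + b) + (g + f)" by simp
  then show "a + e + (d + h) = c + g + (b + f)" by (simp only: add_ac)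
qed

lift_definition uminus_differences :: "'a differences \<Rightarrow> 'a differences"
  is "\<lambda>(x, y). (y, x)"
  by (clarsimp simp: add.commute)

lift_definition minus_differences :: "'a differences \<Rightarrow> 'a differences \<Rightarrow> 'a differences"
  is "\<lambda>(x, y) (u, v). (x + v, y + u)"
proof clarsimp
  fix a b c d e f g h :: 'a
  assume "a + d = c + b" "e + h = g + f"
  then have "(a + d) + (g + f) = (c + b) + (e + h)" by simp
  then show "a + f + (d + g) = c + h + (b + e)" by (simp only: add_ac)
qed

lift_definition times_differences :: "'a differences \<Rightarrow> 'a differences \<Rightarrow> 'a differences"
  is "\<lambda>(x, y) (u, v). (x * u + y * v, x * v + y * u)"
proof (unfold diff_rel_def, clarify)
  fix s t u v w x y z :: 'a
  assume "s + v = u + t" and "w + z = y + x"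
  \<comment> \<open>The first hypothesis is multiplied by \<open>w\<close> and \<open>x\<close>, the
    second by \<open>u\<close> and \<open>v\<close>. The surplus terms form the same sum on both
    sides and are cancelled afterwards.\<close>
  then have "(s + v) * w + (u + t) * x + u * (w + z) + v * (y + x) =
    (u + t) * w + (s + v) * x + u * (y + x) + v * (w + z)"
    by simp
  then have "((s * w + t * x) + (u * z + v * y)) + (u * w + u * x + v * w + v * x)
    = ((u * y + v * z) + (s * x + t * w)) + (u * w + u * x + v * w + v * x)"
    by (simp add: algebra_simps)
  then show "(s * w + t * x) + (u * z + v * y) = (u * y + v * z) + (s * x + t * w)"
    by (rule add_right_imp_eq)
qed

instance
  by standard (transfer; clarsimp simp: algebra_simps)+

end

instantiation differences :: (linordered_semidom) linordered_idom
begin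

lift_definition less_eq_differences :: "'a differences \<Rightarrow> 'a differences \<Rightarrow> bool"
  is "\<lambda>(x, y) (u, v). x + v \<le> u + y"
proof clarsimp
  fix a b c d e f g h :: 'a
  assume "a + d = c + b" "e + h = g + f"
  then have "(a + d) + (f + h) = (c + b) + (f + h)" "(e + h) + (b + d) = (g + f) + (b + d)"
    by simp_all
  then have "(a + f) + (d + h) = (c + h) + (b + f)" "(e + b) + (d + h) = (g + d) + (b + f)"
    by (simp_all only: add_ac)
  then show "a + f \<le> e + b \<longleftrightarrow> c + h \<le> g + d"
    using add_le_cancel_right[of "a + f" "d + h" "e + b"] add_le_cancel_right[of "c + h" "b + f" "g + d"]
    by simp
qed

lift_definition less_differences :: "'a differences \<Rightarrow> 'a differences \<Rightarrow> bool"
  is "\<lambda>(x, y) (u, v). x + v < u + y"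
proof clarsimp
  fix a b c d e f g h :: 'a
  assume "a + d = c + b" "e + h = g + f"
  then have "(a + d) + (f + h) = (c + b) + (f + h)" "(e + h) + (b + d) = (g + f) + (b + d)"
    by simp_all
  then have "(a + f) + (d + h) = (c + h) + (b + f)" "(e + b) + (d + h) = (g + d) + (b + f)"
    by (simp_all only: add_ac)
  then show "a + f < e + b \<longleftrightarrow> c + h < g + d"
    using add_less_cancel_right[of "a + f" "d + h" "e + b"] add_less_cancel_right[of "c + h" "b + f" "g + d"]
    by simp
qed

definition abs_differences :: "'a differences \<Rightarrow> 'a differences" where
  "abs_differences x = (if x < 0 then - x else x)"

definition sgn_differences :: "'a differences \<Rightarrow> 'a differences" where
  "sgn_differences x = (if x = 0 then 0 else if 0 < x then 1 else - 1)"

instance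
proof
  fix x y z :: "'a differences"
  show "x < y \<longleftrightarrow> x \<le> y \<and> \<not> y \<le> x"
    by transfer (auto simp: not_le)
  show "x \<le> x"
    by transfer auto
  show "x \<le> y \<Longrightarrow> y \<le> z \<Longrightarrow> x \<le> z"
  proof (transfer, clarsimp)
    fix a b c d e f :: 'a
    assume "a + d \<le> c + b" "c + f \<le> e + d"
    then have "(a + d) + (c + f) \<le> (c + b) + (e + d)"
      by (rule add_mono)
    then have "(a + f) + (c + d) \<le> (e + b) + (c + d)"
      by (simp add: add_ac)
    then show "a + f \<le> e + b" by simp
  qed
  show "x \<le> y \<Longrightarrow> y \<le> x \<Longrightarrow> x = y"
    by transfer auto
  show "x \<le> y \<or> y \<le> x"
    by transfer auto
  show "x \<le> y \<Longrightarrow> z + x \<le> z + y"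
  proof (transfer, clarsimp)
    fix a b c d e f :: 'a
    assume "a + d \<le> c + b"
    then have "(a + d) + (e + f) \<le> (c + b) + (e + f)" by simp
    then show "e + a + (f + d) \<le> e + c + (f + b)" by (simp add: add_ac)
  qed
  show "x < y \<Longrightarrow> 0 < z \<Longrightarrow> z * x < z * y"
  proof (transfer, clarsimp)
    fix p q r s x y :: 'a
    assume less: "p + s < r + q" and "y < x"
    define k where "k = x - y"
    have x: "x = y + k"
      using \<open>y < x\<close> le_add_diff_inverse2[of y x] by (simp add: k_def add.commute)
    have "0 < k"
      using \<open>y < x\<close> add_less_cancel_left[of y 0 k] unfolding x by simp
    have "k * (p + s) < k * (r + q)"
      using less \<open>0 < k\<close> by (rule mult_strict_left_mono)
    \<comment> \<open>The common summand restores the multiples of \<open>y\<close> that are split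
      off by \<open>x = y + k\<close>.\<close>
    then have "k * (p + s) + y * (p + q + r + s) < k * (r + q) + y * (p + q + r + s)"
      by simp
    then show "x * p + y * q + (x * s + y * r) < x * r + y * s + (x * q + y * p)"
      unfolding x by (simp add: algebra_simps)
  qed
  show "\<bar>x\<bar> = (if x < 0 then - x else x)"
    by (rule abs_differences_def)
  show "sgn x = (if x = 0 then 0 else if 0 < x then 1 else - 1)"
    by (rule sgn_differences_def)
qed

end

subsection \<open>The ordered field of rational numbers\<close>

lift_definition diff_of :: "'a::linordered_semidom \<Rightarrow> 'a differences" is "\<lambda>n. (n, 0)" .

lemma diff_of_hom:
  "diff_of 0 = 0" "diff_of 1 = 1" "diff_of (m + n) = diff_of m + diff_of n"
  "diff_of (m * n) = diff_of m * diff_of n"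
  by (transfer; simp)+

lemma diff_of_less_iff: "diff_of m < diff_of n \<longleftrightarrow> m < n"
  by transfer simp

definition frac_of :: "'a::linordered_semidom \<Rightarrow> 'a differences fract" where
  "frac_of n = Fract (diff_of n) 1"

lemma frac_of_hom [simp]:
  "frac_of 0 = 0" "frac_of 1 = 1" "frac_of (m + n) = frac_of m + frac_of n"
  "frac_of (m * n) = frac_of m * frac_of n"
  by (simp_all add: frac_of_def diff_of_hom fract_collapse)

lemma frac_of_less_iff [simp]: "frac_of m < frac_of n \<longleftrightarrow> m < n"
  by (simp add: frac_of_def diff_of_less_iff)

lemma frac_of_eq_iff [simp]: "frac_of m = frac_of n \<longleftrightarrow> m = n"
  by (metis frac_of_less_iff neq_iff)

lemma frac_of_eq_0_iff [simp]: "frac_of n = 0 \<longleftrightarrow> n = 0"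
  using frac_of_eq_iff[of n 0] by simp

lemma frac_of_pos: "n \<noteq> 0 \<Longrightarrow> 0 < frac_of (n :: 'a::ast anat)"
  using frac_of_less_iff[of 0 n] by (simp add: anat_pos_iff)

lemma same_frac_iff:
  assumes "c \<noteq> 0" "c' \<noteq> 0"
  shows "same_frac a b c a' b' c' \<longleftrightarrow>
    (frac_of a - frac_of b) / frac_of c = (frac_of a' - frac_of b') / frac_of c'"
proof -
  have "same_frac a b c a' b' c' \<longleftrightarrow> frac_of (a * c' + b' * c) = frac_of (a' * c + b * c')"
    unfolding same_frac_def frac_of_eq_iff ..
  also have "\<dots> \<longleftrightarrow> (frac_of a - frac_of b) * frac_of c' = (frac_of a' - frac_of b') * frac_of c"
    by (auto simp: algebra_simps)
  also have "\<dots> \<longleftrightarrow> (frac_of a - frac_of b) / frac_of c = (frac_of a' - frac_of b') / frac_of c'"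
    using assms by (simp add: frac_eq_eq)
  finally show ?thesis .
qed

section \<open>Representation of rational numbers in lowest terms\<close>

lemma sdef_same_frac [sdef_intros]:
  assumes "ndef a" "ndef b" "ndef c" "ndef a'" "ndef b'" "ndef c'"
  shows "sdef (\<lambda>e. same_frac (a e) (b e) (c e) (a' e) (b' e) (c' e))"
  unfolding same_frac_def by (intro sdef_intros assms)

lemma lowest_terms_nonzero: "lowest_terms a b c \<Longrightarrow> c \<noteq> 0"
  by (simp add: lowest_terms_def)

text \<open>The least denominator of an equivalent triple takes the place of a gcd computation; it
  exists because equivalence of triples is definable.\<close>

lemma lowest_terms_exists:
  assumes c: "c \<noteq> 0"
  shows "\<exists>a' b' c'. lowest_terms a' b' c' \<and> same_frac a b c a' b' c'"
proof -
  define P where "P m \<longleftrightarrow> m \<noteq> 0 \<and> (\<exists>a' b'. same_frac a b c a' b' m)" for m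
  have "sdef (\<lambda>e. P (toN (e 0)))"
    unfolding P_def by (intro sdef_intros)
  moreover have "P c"
    using c by (auto simp: P_def same_frac_def)
  ultimately obtain m where m: "P m" "\<And>k. k < m \<Longrightarrow> \<not> P k"
    using anat_least[of P c] by blast
  then obtain a' b' where ab: "m \<noteq> 0" "same_frac a b c a' b' m"
    by (auto simp: P_def)
  \<comment> \<open>Subtracting the smaller numerator from both makes one of them 0 and keeps their
    difference.\<close>
  define k where "k = min a' b'"
  have le: "k \<le> a'" "k \<le> b'" by (auto simp: k_def)
  have k: "a' = (a' - k) + k" "b' = (b' - k) + k"
    using le by simp_all
  have "frac_of a' - frac_of b' = frac_of ((a' - k) + k) - frac_of ((b' - k) + k)"
    using k by simp
  then have val: "frac_of a' - frac_of b' = frac_of (a' - k) - frac_of (b' - k)"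
    by simp
  have same: "same_frac a b c (a' - k) (b' - k) m"
    using ab val by (simp add: same_frac_iff c)
  moreover have "lowest_terms (a' - k) (b' - k) m"
    unfolding lowest_terms_def
  proof (intro conjI allI impI)
    show "m \<noteq> 0" by fact
    show "a' - k = 0 \<or> b' - k = 0"
      by (cases "a' \<le> b'") (auto simp: k_def min_def)
    fix x y z
    assume "z \<noteq> 0" "same_frac (a' - k) (b' - k) m x y z"
    then have "same_frac a b c x y z"
      using same c ab(1) by (simp add: same_frac_iff)
    then show "\<not> z < m"
      using m(2)[of z] \<open>z \<noteq> 0\<close> by (auto simp: P_def)
  qed
  ultimately show ?thesis by blast
qed

lemma anat_add_eq_0_iff: "m + n = 0 \<longleftrightarrow> m = 0 \<and> n = (0 :: 'a::ast anat)"
  by (simp add: add_nonneg_eq_0_iff)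

text \<open>Minimality in both directions equates the denominators, which then cancel. What remains
  is \<open>a + b' = a' + b\<close> with a zero in each pair, and a sum vanishes only if both
  summands do.\<close>

lemma lowest_terms_unique:
  assumes "lowest_terms a b c" "lowest_terms a' b' c'" "same_frac a b c a' b' c'"
  shows "a = a' \<and> b = b' \<and> c = c'"
proof -
  note nz = assms(1,2)[THEN lowest_terms_nonzero]
  have "same_frac a' b' c' a b c"
    using assms(3) nz by (simp add: same_frac_iff)
  then have "\<not> c < c'"
    using assms(2) nz unfolding lowest_terms_def by blast
  moreover have "\<not> c' < c"
    using assms(1,3) nz unfolding lowest_terms_def by blast
  ultimately have c: "c = c'" by simp
  then have "(a + b') * c = (a' + b) * c"
    using assms(3) by (simp add: same_frac_def distrib_right)
  then have "frac_of ((a + b') * c) = frac_of ((a' + b) * c)"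
    by (rule arg_cong)
  then have "frac_of (a + b') = frac_of (a' + b)"
    using nz(1) unfolding frac_of_hom(4) by simp
  then have eq: "a + b' = a' + b"
    by (simp only: frac_of_eq_iff)
  have "a = 0 \<or> b = 0" "a' = 0 \<or> b' = 0"
    using assms(1,2) by (simp_all add: lowest_terms_def)
  then show ?thesis
    using eq c by (auto simp: anat_add_eq_0_iff eq_commute[of 0])
qed

lemma rat_code_inject [simp]:
  "rat_code a b c = rat_code a' b' c' \<longleftrightarrow> a = a' \<and> b = b' \<and> c = c'"
  by (simp add: rat_code_def Rep_anat_inject)

lemma arat_parts:
  "lowest_terms (pos_num q) (neg_num q) (denom q)"
  "Rep_arat q = rat_code (pos_num q) (neg_num q) (denom q)"
proof -
  obtain a b c where abc: "Rep_arat q = rat_code a b c" "lowest_terms a b c"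
    using Rep_arat[of q] by blast
  then have "pos_num q = a" "neg_num q = b" "denom q = c"
    by (simp_all add: pos_num_def neg_num_def denom_def)
  then show "lowest_terms (pos_num q) (neg_num q) (denom q)"
    "Rep_arat q = rat_code (pos_num q) (neg_num q) (denom q)"
    using abc by simp_all
qed

lemma parts_of_code:
  assumes "Rep_arat q = rat_code a b c"
  shows "pos_num q = a" "neg_num q = b" "denom q = c"
  using assms by (simp_all add: arat_parts(2))

lemma denom_nonzero [simp]: "denom q \<noteq> 0"
  by (rule lowest_terms_nonzero[OF arat_parts(1)])

text \<open>All field axioms are pulled back along this injection.\<close>

definition aval :: "'a::ast arat \<Rightarrow> 'a anat differences fract" where
  "aval q = (frac_of (pos_num q) - frac_of (neg_num q)) / frac_of (denom q)"

lemma aval_inject: "aval p = aval q \<longleftrightarrow> p = q"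
proof
  assume "aval p = aval q"
  then have "same_frac (pos_num p) (neg_num p) (denom p) (pos_num q) (neg_num q) (denom q)"
    by (simp add: aval_def same_frac_iff)
  from lowest_terms_unique[OF arat_parts(1) arat_parts(1) this] show "p = q"
    by (simp add: Rep_arat_inject[symmetric] arat_parts(2))
qed simp

lemma Rep_afrac:
  assumes "c \<noteq> 0"
  shows "\<exists>a' b' c'. lowest_terms a' b' c' \<and> same_frac a b c a' b' c'
    \<and> Rep_arat (afrac a b c) = rat_code a' b' c'"
  unfolding afrac_def
proof (rule theI')
  obtain a' b' c' where abc: "lowest_terms a' b' c'" "same_frac a b c a' b' c'"
    using lowest_terms_exists[OF assms] by blast
  have rep: "Rep_arat (Abs_arat (rat_code a' b' c')) = rat_code a' b' c'"
    by (rule Abs_arat_inverse) (use abc in blast)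
  show "\<exists>!q. \<exists>a' b' c'. lowest_terms a' b' c' \<and> same_frac a b c a' b' c'
    \<and> Rep_arat q = rat_code a' b' c'"
  proof (rule ex1I[of _ "Abs_arat (rat_code a' b' c')"])
    show "\<exists>x y z. lowest_terms x y z \<and> same_frac a b c x y z
      \<and> Rep_arat (Abs_arat (rat_code a' b' c')) = rat_code x y z"
      using abc rep by blast
    fix q
    assume "\<exists>x y z. lowest_terms x y z \<and> same_frac a b c x y z \<and> Rep_arat q = rat_code x y z"
    then obtain x y z where xyz: "lowest_terms x y z" "same_frac a b c x y z" "Rep_arat q = rat_code x y z"
      by blast
    have "same_frac x y z a' b' c'"
      using abc xyz assms lowest_terms_nonzero[OF abc(1)] lowest_terms_nonzero[OF xyz(1)]
      by (simp add: same_frac_iff)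
    from lowest_terms_unique[OF xyz(1) abc(1) this] show "q = Abs_arat (rat_code a' b' c')"
      using rep xyz(3) by (simp add: Rep_arat_inject[symmetric])
  qed
qed

lemma aval_afrac:
  assumes "c \<noteq> 0"
  shows "aval (afrac a b c) = (frac_of a - frac_of b) / frac_of c"
proof -
  obtain a' b' c' where abc: "lowest_terms a' b' c'" "same_frac a b c a' b' c'"
    "Rep_arat (afrac a b c) = rat_code a' b' c'"
    using Rep_afrac[OF assms] by blast
  show ?thesis
    using abc(2) assms lowest_terms_nonzero[OF abc(1)]
    by (simp add: aval_def parts_of_code[OF abc(3)] same_frac_iff)
qed

lemma aval_hom [simp]:
  "aval 0 = 0" "aval 1 = 1" "aval (p + q) = aval p + aval q" "aval (- p) = - aval p"
  "aval (p - q) = aval p - aval q" "aval (p * q) = aval p * aval q"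
  "aval (inverse p) = inverse (aval p)" "aval (p / q) = aval p / aval q"
  "aval (of_anat n) = frac_of n"
proof -
  show add: "aval (p + q) = aval p + aval q" for p q
    by (simp add: plus_arat_def aval_afrac) (simp add: aval_def field_simps)
  show minus: "aval (- p) = - aval p" for p
    by (simp add: uminus_arat_def aval_afrac) (simp add: aval_def field_simps)
  show "aval (p - q) = aval p - aval q"
    by (simp add: minus_arat_def add minus)
  show mult: "aval (p * q) = aval p * aval q" for p q
    by (simp add: times_arat_def aval_afrac) (simp add: aval_def field_simps)
  show inv: "aval (inverse p) = inverse (aval p)" for p
  proof -
    \<comment> \<open>The case distinction in \<open>inverse_arat\<close> is one on the sign of
      \<open>p\<close>, because one numerator of a code vanishes.\<close>
    have "pos_num p = 0 \<or> neg_num p = 0"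
      using arat_parts(1)[of p] by (simp add: lowest_terms_def)
    then show ?thesis
      by (auto simp: inverse_arat_def aval_afrac zero_arat_def) (auto simp: aval_def divide_simps)
  qed
  show "aval (p / q) = aval p / aval q"
    by (simp add: divide_arat_def mult inv divide_inverse)
qed (simp_all add: zero_arat_def one_arat_def of_anat_def aval_afrac)

lemma aval_less_iff [simp]: "aval p < aval q \<longleftrightarrow> p < q"
proof -
  have pos: "0 < frac_of (denom p)" "0 < frac_of (denom q)"
    by (simp_all add: frac_of_pos)
  have "p < q \<longleftrightarrow> frac_of (pos_num p * denom q + neg_num q * denom p)
      < frac_of (pos_num q * denom p + neg_num p * denom q)"
    unfolding less_arat_def frac_of_less_iff ..
  also have "\<dots> \<longleftrightarrow> (frac_of (pos_num p) - frac_of (neg_num p)) * frac_of (denom q)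
      < (frac_of (pos_num q) - frac_of (neg_num q)) * frac_of (denom p)"
    by (auto simp: algebra_simps)
  also have "\<dots> \<longleftrightarrow> aval p < aval q"
    using pos by (simp add: aval_def pos_divide_less_eq pos_less_divide_eq mult.commute)
  finally show ?thesis by simp
qed

lemma aval_le_iff [simp]: "aval p \<le> aval q \<longleftrightarrow> p \<le> q"
  unfolding less_eq_arat_def by (simp add: order.order_iff_strict aval_inject)

instantiation arat :: (ast) sgn
begin

definition sgn_arat :: "'a arat \<Rightarrow> 'a arat" where
  "sgn_arat p = (if p = 0 then 0 else if 0 < p then 1 else - 1)"

instance ..

end

instance arat :: (ast) linordered_field
proof
  fix a b c :: "'a arat"
  show "a + b + c = a + (b + c)" "a + b = b + a" "0 + a = a" "a * b * c = a * (b * c)"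
    "a * b = b * a" "1 * a = a" "(a + b) * c = a * c + b * c" "- a + a = 0" "a - b = a + - b"
    "a + b - a = b" "a - b - c = a - (b + c)" "0 * a = 0" "a * 0 = 0"
    "0 \<noteq> (1 :: 'a arat)" "inverse (0 :: 'a arat) = 0" "a div b = a * inverse b"
    by (simp_all add: aval_inject[symmetric] algebra_simps divide_inverse)
  show "a \<noteq> 0 \<Longrightarrow> inverse a * a = 1"
    by (simp add: aval_inject[symmetric])
  show "a < b \<longleftrightarrow> a \<le> b \<and> \<not> b \<le> a" "a \<le> a" "a \<le> b \<or> b \<le> a"
    by (auto simp: aval_less_iff[symmetric] aval_le_iff[symmetric] simp del: aval_less_iff aval_le_iff)
  show "a \<le> b \<Longrightarrow> b \<le> c \<Longrightarrow> a \<le> c" "a \<le> b \<Longrightarrow> b \<le> a \<Longrightarrow> a = b"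
    "a \<le> b \<Longrightarrow> c + a \<le> c + b"
    by (auto simp: aval_inject[symmetric] aval_le_iff[symmetric] simp del: aval_le_iff)
  show "a < b \<Longrightarrow> 0 < c \<Longrightarrow> c * a < c * b"
    by (auto simp: aval_less_iff[symmetric] simp del: aval_less_iff)
  show "\<bar>a\<bar> = (if a < 0 then - a else a)"
    by (rule abs_arat_def)
  show "sgn a = (if a = 0 then 0 else if 0 < a then 1 else - 1)"
    by (rule sgn_arat_def)
qed

lemma of_anat_hom [simp]:
  "of_anat 0 = 0" "of_anat 1 = 1" "of_anat (m + n) = of_anat m + of_anat n"
  "of_anat (m * n) = of_anat m * of_anat n"
  by (simp_all add: aval_inject[symmetric])

lemma of_anat_less_iff [simp]: "of_anat m < of_anat n \<longleftrightarrow> m < n"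
  by (simp add: aval_less_iff[symmetric] del: aval_less_iff)

lemma of_anat_eq_iff [simp]: "of_anat m = of_anat n \<longleftrightarrow> m = n"
  by (simp add: aval_inject[symmetric])

lemma of_anat_le_iff [simp]: "of_anat m \<le> of_anat n \<longleftrightarrow> m \<le> n"
  by (simp add: order.order_iff_strict)

lemma of_anat_pos: "n \<noteq> 0 \<Longrightarrow> 0 < of_anat n"
  using of_anat_less_iff[of 0 n] by (simp add: anat_pos_iff)

subsection \<open>Definability of rational arithmetic\<close>

definition qdef :: "((nat \<Rightarrow> 'a) \<Rightarrow> 'a::ast arat) \<Rightarrow> bool" where
  "qdef u \<longleftrightarrow> tdef (\<lambda>e. Rep_arat (u e))"

lemma ndef_shift2: "ndef u \<Longrightarrow> ndef (\<lambda>e. u (\<lambda>n. e (Suc (Suc n))))"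
  by (rule ndef_shift[OF ndef_shift])

lemma ndef_shift3: "ndef u \<Longrightarrow> ndef (\<lambda>e. u (\<lambda>n. e (Suc (Suc (Suc n)))))"
  by (rule ndef_shift[OF ndef_shift2])

lemma ndef_shift4: "ndef u \<Longrightarrow> ndef (\<lambda>e. u (\<lambda>n. e (Suc (Suc (Suc (Suc n))))))"
  by (rule ndef_shift[OF ndef_shift3])

lemma sdef_lowest_terms [sdef_intros]:
  assumes "ndef a" "ndef b" "ndef c"
  shows "sdef (\<lambda>e. lowest_terms (a e) (b e) (c e))"
  unfolding lowest_terms_def
  by (intro sdef_intros assms assms[THEN ndef_shift3])

lemma tdef_rat_code [sdef_intros]:
  assumes "ndef a" "ndef b" "ndef c"
  shows "tdef (\<lambda>e. rat_code (a e) (b e) (c e))"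
  unfolding rat_code_def by (intro sdef_intros assms)

lemma tdef_Rep_arat [sdef_intros]: "qdef u \<Longrightarrow> tdef (\<lambda>e. Rep_arat (u e))"
  by (simp add: qdef_def)

lemma qdef_const [sdef_intros]: "qdef (\<lambda>e. c)"
  unfolding qdef_def by (rule tdef_const)

lemma sdef_eq_arat [sdef_intros]:
  assumes "qdef u" "qdef v"
  shows "sdef (\<lambda>e. u e = v e)"
  unfolding Rep_arat_inject[symmetric] by (intro sdef_intros assms)

lemma qdef_shift: "qdef u \<Longrightarrow> qdef (\<lambda>e. u (\<lambda>n. e (Suc n)))"
  unfolding qdef_def by (rule tdef_shift)

text \<open>Quantifier rules exist for sets and natural numbers but not for rationals. Hence the
  graph of \<open>F\<close> is rewritten as a relation \<open>R\<close> between the underlying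
  sets.\<close>

lemma ndef_subst_Rep:
  assumes "\<And>z x. z = Rep_anat (F x) \<longleftrightarrow> R z (Rep_arat x)" "sdef (\<lambda>e. R (e 0) (e 1))" "qdef u"
  shows "ndef (\<lambda>e. F (u e))"
  unfolding ndef_def tdef_def assms(1)
  by (rule sdef_subst2[OF assms(2)]) (intro sdef_intros qdef_shift[OF assms(3)])+

lemma ndef_parts [sdef_intros]:
  assumes "qdef u"
  shows "ndef (\<lambda>e. pos_num (u e))" "ndef (\<lambda>e. neg_num (u e))" "ndef (\<lambda>e. denom (u e))"
proof -
  have code: "Rep_arat x = rat_code a b c \<longleftrightarrow> a = pos_num x \<and> b = neg_num x \<and> c = denom x" for x :: "'a arat" and a b c
    using arat_parts(2)[of x] by auto
  show "ndef (\<lambda>e. pos_num (u e))"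
    by (rule ndef_subst_Rep[where R = "\<lambda>z y. \<exists>a b c. y = rat_code a b c \<and> z = Rep_anat a", OF _ _ assms])
      (auto simp: code intro!: sdef_intros)
  show "ndef (\<lambda>e. neg_num (u e))"
    by (rule ndef_subst_Rep[where R = "\<lambda>z y. \<exists>a b c. y = rat_code a b c \<and> z = Rep_anat b", OF _ _ assms])
      (auto simp: code intro!: sdef_intros)
  show "ndef (\<lambda>e. denom (u e))"
    by (rule ndef_subst_Rep[where R = "\<lambda>z y. \<exists>a b c. y = rat_code a b c \<and> z = Rep_anat c", OF _ _ assms])
      (auto simp: code intro!: sdef_intros)
qed

text \<open>\<open>afrac\<close> is a description that is meaningful for nonzero denominators, so
  nonvanishing is required in every environment. Uniqueness of lowest terms replaces the description
  by an existential statement.\<close>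

lemma qdef_afrac:
  assumes "ndef a" "ndef b" "ndef c" and nz: "\<And>e. c e \<noteq> 0"
  shows "qdef (\<lambda>e. afrac (a e) (b e) (c e))"
proof -
  have eq: "z = Rep_arat (afrac x y w) \<longleftrightarrow>
      (\<exists>a' b' c'. lowest_terms a' b' c' \<and> same_frac x y w a' b' c' \<and> z = rat_code a' b' c')"
    if nz: "w \<noteq> 0" for z x y w
  proof
    assume "z = Rep_arat (afrac x y w)"
    then show "\<exists>a' b' c'. lowest_terms a' b' c' \<and> same_frac x y w a' b' c' \<and> z = rat_code a' b' c'"
      using Rep_afrac[OF nz] by simp
  next
    assume "\<exists>a' b' c'. lowest_terms a' b' c' \<and> same_frac x y w a' b' c' \<and> z = rat_code a' b' c'"
    then obtain a' b' c' where abc: "lowest_terms a' b' c'" "same_frac x y w a' b' c'" "z = rat_code a' b' c'"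
      by blast
    obtain a'' b'' c'' where abc': "lowest_terms a'' b'' c''" "same_frac x y w a'' b'' c''"
      "Rep_arat (afrac x y w) = rat_code a'' b'' c''"
      using Rep_afrac[OF nz] by blast
    have "same_frac a' b' c' a'' b'' c''"
      using abc(2) abc'(2) nz lowest_terms_nonzero[OF abc(1)] lowest_terms_nonzero[OF abc'(1)]
      by (simp add: same_frac_iff)
    from lowest_terms_unique[OF abc(1) abc'(1) this] show "z = Rep_arat (afrac x y w)"
      using abc(3) abc'(3) by simp
  qed
  show ?thesis
    unfolding qdef_def tdef_def eq[OF nz]
    by (intro sdef_intros assms(1-3)[THEN ndef_shift4])
qed

lemma qdef_of_anat [sdef_intros]:
  assumes "ndef u"
  shows "qdef (\<lambda>e. of_anat (u e))"
  unfolding of_anat_def by (intro qdef_afrac sdef_intros assms) simp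

lemma qdef_plus [sdef_intros]:
  assumes "qdef u" "qdef v"
  shows "qdef (\<lambda>e. u e + v e)"
  unfolding plus_arat_def by (intro qdef_afrac sdef_intros assms) simp

lemma qdef_uminus [sdef_intros]:
  assumes "qdef u"
  shows "qdef (\<lambda>e. - u e)"
  unfolding uminus_arat_def by (intro qdef_afrac sdef_intros assms) simp

lemma qdef_minus [sdef_intros]:
  assumes "qdef u" "qdef v"
  shows "qdef (\<lambda>e. u e - v e)"
  unfolding minus_arat_def by (intro sdef_intros assms)

lemma qdef_times [sdef_intros]:
  assumes "qdef u" "qdef v"
  shows "qdef (\<lambda>e. u e * v e)"
  unfolding times_arat_def by (intro qdef_afrac sdef_intros assms) simp

lemma sdef_less_arat [sdef_intros]:
  assumes "qdef u" "qdef v"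
  shows "sdef (\<lambda>e. u e < v e)"
  unfolding less_arat_def by (intro sdef_intros assms)

lemma sdef_le_arat [sdef_intros]:
  assumes "qdef u" "qdef v"
  shows "sdef (\<lambda>e. u e \<le> v e)"
  unfolding less_eq_arat_def by (intro sdef_intros assms)

lemma sdef_abs_less [sdef_intros]:
  assumes "qdef u" "qdef v"
  shows "sdef (\<lambda>e. \<bar>u e\<bar> < v e)"
  unfolding abs_less_iff by (intro sdef_intros assms)

lemma sdef_abs_le [sdef_intros]:
  assumes "qdef u" "qdef v"
  shows "sdef (\<lambda>e. \<bar>u e\<bar> \<le> v e)"
  unfolding abs_le_iff by (intro sdef_intros assms)

subsection \<open>Difference quotients\<close>

text \<open>Overspill: the least \<open>k\<close> with \<open>P k\<close> cannot be infinite, since then its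
  predecessor would be infinite too.\<close>

lemma FN_overspill:
  fixes P :: "'a::ast anat \<Rightarrow> bool" and \<tau> :: "'a anat"
  assumes "sdef (\<lambda>e. P (toN (e 0)))" "\<tau> \<notin> FN" "\<And>k. k \<notin> FN \<Longrightarrow> P k"
  obtains k where "k \<in> FN" "P k"
proof -
  obtain m where m: "P m" "\<And>k. k < m \<Longrightarrow> \<not> P k"
    using anat_least[of P \<tau>] assms by blast
  have "m \<in> FN"
  proof (rule ccontr)
    assume "m \<notin> FN"
    then have "m \<noteq> 0" using zero_in_FN by auto
    then obtain k where k: "m = k + 1"
      by (cases m rule: anat_exhaust) (auto simp: asuc_eq)
    then have "k \<notin> FN" using \<open>m \<notin> FN\<close> FN_add_1 by blast
    then have "P k" by (rule assms(3))
    moreover have "k < m" using k by simp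
    ultimately show False using m(2) by blast
  qed
  then show ?thesis using that m(1) by blast
qed

lemma anat_less_imp_succ_le:
  assumes "m < n"
  shows "m + 1 \<le> (n :: 'a::ast anat)"
proof (cases n rule: anat_exhaust)
  case 1
  then show ?thesis using assms by (simp add: anat_not_less_0)
next
  case (2 k)
  then have "m \<le> k" using assms by (simp only: anat_less_asuc)
  then show ?thesis by (simp add: 2 asuc_eq)
qed

lemma grid_iff:
  "s \<in> grid \<tau> \<longleftrightarrow> (\<exists>n\<le>\<tau>. s = of_anat n * eps \<tau>)"
  by (auto simp: grid_def eps_def)

text \<open>Here it matters that \<open>f\<close> is a set: its values are read off from membership
  of pairs in \<open>f\<close>. Definability concerns all environments, including indices beyond
  \<open>\<tau>\<close>, where \<open>f\<close> has no value; the default 0 covers these.\<close>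

lemma qdef_grid_values:
  assumes f: "rat_function (elts f) (grid \<tau>)" and u: "ndef u"
  shows "qdef (\<lambda>e. if u e \<le> \<tau> then rapp (elts f) (of_anat (u e) * eps \<tau>) else 0)"
proof -
  have cf: "class_function (elts f) (Rep_arat ` grid \<tau>) (range Rep_arat)"
    using f by (simp add: rat_function_def)
  have eq: "z = Rep_arat (if n \<le> \<tau> then rapp (elts f) (of_anat n * eps \<tau>) else 0) \<longleftrightarrow>
      (n \<le> \<tau> \<and> opair (Rep_arat (of_anat n * eps \<tau>)) z \<in> elts f) \<or> (\<not> n \<le> \<tau> \<and> z = Rep_arat 0)"
    for z n
  proof (cases "n \<le> \<tau>")
    case True
    let ?s = "Rep_arat (of_anat n * eps \<tau>)"
    have s: "?s \<in> Rep_arat ` grid \<tau>"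
      using True grid_iff by blast
    note app = app_eq_iff[OF cf s]
    have "opair ?s (app (elts f) ?s) \<in> elts f"
      using app[THEN iffD1] by simp
    then have "app (elts f) ?s \<in> range Rep_arat"
      using cf unfolding class_function_def by fastforce
    then have "Rep_arat (rapp (elts f) (of_anat n * eps \<tau>)) = app (elts f) ?s"
      unfolding rapp_def by (auto simp: Rep_arat_inverse)
    then show ?thesis
      using True app[of z] by auto
  qed simp
  show ?thesis
    unfolding qdef_def tdef_def eq
    by (intro sdef_intros ndef_shift[OF u])
qed

text \<open>No sum over the indices below \<open>m\<close> is ever formed. The estimate itself is
  the induction formula, and the triangle inequality adds one \<open>r\<close> per step. The
  assumption \<open>def\<close> lets \<open>\<phi>\<close> occur in this formula.\<close>

lemma telescoping_bound:
  fixes \<phi> :: "'a::ast anat \<Rightarrow> 'a arat"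
  assumes def: "\<And>u. ndef u \<Longrightarrow> qdef (\<lambda>e. \<phi> (u e))"
    and step: "\<And>i. i < m \<Longrightarrow> \<bar>\<phi> (i + 1) - \<phi> i - d\<bar> \<le> r"
  shows "\<bar>\<phi> m - \<phi> 0 - of_anat m * d\<bar> \<le> of_anat m * r"
proof -
  \<comment> \<open>The premise \<open>i \<le> m\<close> belongs to the induction formula because
    increments are controlled below \<open>m\<close> only.\<close>
  have "i \<le> m \<longrightarrow> \<bar>\<phi> i - \<phi> 0 - of_anat i * d\<bar> \<le> of_anat i * r" for i
  proof (rule anat_induct[of "\<lambda>i. i \<le> m \<longrightarrow> \<bar>\<phi> i - \<phi> 0 - of_anat i * d\<bar> \<le> of_anat i * r"])
    show "sdef (\<lambda>e. toN (e 0) \<le> m \<longrightarrow>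
        \<bar>\<phi> (toN (e 0)) - \<phi> 0 - of_anat (toN (e 0)) * d\<bar> \<le> of_anat (toN (e 0)) * r)"
      by (intro sdef_intros def)
    show "0 \<le> m \<longrightarrow> \<bar>\<phi> 0 - \<phi> 0 - of_anat 0 * d\<bar> \<le> of_anat 0 * r"
      by simp
    fix i
    assume IH: "i \<le> m \<longrightarrow> \<bar>\<phi> i - \<phi> 0 - of_anat i * d\<bar> \<le> of_anat i * r"
    show "asuc i \<le> m \<longrightarrow> \<bar>\<phi> (asuc i) - \<phi> 0 - of_anat (asuc i) * d\<bar> \<le> of_anat (asuc i) * r"
    proof
      assume "asuc i \<le> m"
      moreover have "i < asuc i" by (simp add: asuc_eq)
      ultimately have "i < m" by (rule less_le_trans[rotated])
      then have 1: "\<bar>\<phi> (i + 1) - \<phi> i - d\<bar> \<le> r" and 2: "\<bar>\<phi> i - \<phi> 0 - of_anat i * d\<bar> \<le> of_anat i * r"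
        using step IH by auto
      have "\<phi> (asuc i) - \<phi> 0 - of_anat (asuc i) * d
          = (\<phi> (i + 1) - \<phi> i - d) + (\<phi> i - \<phi> 0 - of_anat i * d)"
        by (simp add: asuc_eq algebra_simps)
      then have "\<bar>\<phi> (asuc i) - \<phi> 0 - of_anat (asuc i) * d\<bar>
          \<le> \<bar>\<phi> (i + 1) - \<phi> i - d\<bar> + \<bar>\<phi> i - \<phi> 0 - of_anat i * d\<bar>"
        by (simp only: abs_triangle_ineq)
      also have "\<dots> \<le> r + of_anat i * r"
        by (rule add_mono[OF 1 2])
      finally show "\<bar>\<phi> (asuc i) - \<phi> 0 - of_anat (asuc i) * d\<bar> \<le> of_anat (asuc i) * r"
        by (simp add: asuc_eq algebra_simps)
    qed
  qed
  then show ?thesis by simp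
qed

text \<open>A finite bound on \<open>p\<close> refutes the second clause of \<open>\<doteq>\<close>,
  leaving the clause that controls the difference.\<close>

lemma indisc_bounded:
  assumes "p \<doteq> q" "p \<in> BQ" "i \<in> FN" "0 < i"
  shows "\<bar>p - q\<bar> < 1 / of_anat i"
proof -
  obtain k where k: "k \<in> FN" "\<bar>p\<bar> \<le> of_anat k"
    using assms(2) by (auto simp: BQ_def)
  then have "\<not> (of_anat k < p \<and> of_anat k < q \<or> p < - of_anat k \<and> q < - of_anat k)"
    by (auto simp: abs_le_iff)
  then show ?thesis
    using assms(1,3,4) k(1) unfolding indisc_def by blast
qed

text \<open>The inequality is strict because the estimate for the quotient will be
  \<open>\<le> 1 / of_anat i\<close>, while the goal asks for \<open><\<close>.\<close>

lemma FQ_bound: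
  assumes "q \<in> FQ" "q \<noteq> 0"
  obtains i where "i \<in> FN" "0 < i" "1 / of_anat i < \<bar>q\<bar>"
proof -
  obtain x y where xy: "x \<in> FN" "y \<in> FN" "y \<noteq> 0" "\<bar>q\<bar> = \<bar>of_anat x / of_anat y\<bar>"
    using assms(1) by (auto simp: FQ_def)
  have y: "0 < of_anat y"
    using xy(3) by (rule of_anat_pos)
  have "x \<noteq> 0" using xy(4) assms(2) by auto
  then obtain x' where "x = x' + 1"
    by (cases x rule: anat_exhaust) (auto simp: asuc_eq)
  then have "1 \<le> of_anat x"
    using of_anat_le_iff[of 0 x'] by (simp del: of_anat_le_iff)
  then have "1 / of_anat y \<le> \<bar>q\<bar>"
    using y xy(4) by (simp add: divide_right_mono)
  \<comment> \<open>Only \<open>1 / y \<le> |q|\<close> is known; enlarging the denominator by 1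
    gives strictness.\<close>
  moreover have "1 / of_anat (y + 1) < 1 / of_anat y"
    using y by (intro divide_strict_left_mono) (auto intro: mult_pos_pos add_pos_pos)
  ultimately have "1 / of_anat (y + 1) < \<bar>q\<bar>"
    by (rule less_le_trans[rotated])
  moreover have "0 < y + 1"
    by (simp add: add_nonneg_pos)
  ultimately show ?thesis
    using that[of "y + 1"] FN_add_1[OF xy(2)] by blast
qed

text \<open>An epsilon-delta form of continuity at \<open>x\<close>. Finiteness of \<open>k\<close>
  is the gain: the radius \<open>1 / k\<close> is not infinitesimal, so a sequence tending to 0 can
  fall below it.\<close>

lemma diff_quot_close:
  fixes \<tau> :: "'a::ast anat"
  assumes \<tau>: "\<tau> \<notin> FN" and f: "rat_function (elts f) (grid \<tau>)"
    and cont: "indisc_continuous (grid \<tau> - {1}) (diff_quot \<tau> f)"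
    and x: "x \<in> grid \<tau> - {1}" and bounded: "diff_quot \<tau> f x \<in> BQ"
    and i: "i \<in> FN" "0 < i"
  obtains k where "k \<in> FN" "\<And>y. y \<in> grid \<tau> - {1} \<Longrightarrow> \<bar>(y - x) * of_anat k\<bar> < 1
    \<Longrightarrow> \<bar>diff_quot \<tau> f y - diff_quot \<tau> f x\<bar> < 1 / of_anat i"
proof -
  have \<tau>0: "\<tau> \<noteq> 0" using \<tau> zero_in_FN by auto
  have eps: "of_anat \<tau> * eps \<tau> = 1"
    using of_anat_pos[OF \<tau>0] by (simp add: eps_def)
  have grid: "y \<in> grid \<tau> - {1} \<longleftrightarrow> (\<exists>n<\<tau>. y = of_anat n * eps \<tau>)" for y
  proof
    assume "y \<in> grid \<tau> - {1}"
    then obtain n where "n \<le> \<tau>" "y = of_anat n * eps \<tau>" "y \<noteq> 1"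
      by (auto simp: grid_iff)
    then show "\<exists>n<\<tau>. y = of_anat n * eps \<tau>"
      using eps by (metis order.not_eq_order_implies_strict)
  next
    assume "\<exists>n<\<tau>. y = of_anat n * eps \<tau>"
    then obtain n where n: "n < \<tau>" "y = of_anat n * eps \<tau>" by blast
    then have "y = of_anat n / of_anat \<tau>" by (simp add: eps_def)
    then have "y \<noteq> 1" using n(1) by (auto simp: divide_eq_1_iff)
    moreover have "y \<in> grid \<tau>"
      using n by (auto simp: grid_iff intro: less_imp_le)
    ultimately show "y \<in> grid \<tau> - {1}" by blast
  qed
  define \<phi> where "\<phi> n = (if n \<le> \<tau> then rapp (elts f) (of_anat n * eps \<tau>) else 0)" for n
  have \<phi>: "qdef (\<lambda>e. \<phi> (u e))" if "ndef u" for u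
    unfolding \<phi>_def by (rule qdef_grid_values[OF f that])
  have quot: "diff_quot \<tau> f (of_anat n * eps \<tau>) = (\<phi> (n + 1) - \<phi> n) * of_anat \<tau>" if "n < \<tau>" for n
  proof -
    have "n + 1 \<le> \<tau>"
      using that by (rule anat_less_imp_succ_le)
    moreover have "of_anat n * eps \<tau> + eps \<tau> = of_anat (n + 1) * eps \<tau>"
      by (simp add: algebra_simps)
    ultimately show ?thesis
      using less_imp_le[OF that] by (simp add: diff_quot_def \<phi>_def eps_def)
  qed
  \<comment> \<open>The quantifier runs over numerators \<open>n\<close>, since rationals have no
    quantifier rule, and \<open>\<tau>\<close> multiplies where \<open>eps \<tau>\<close> would
    divide, since definability is established for products. The quotient at \<open>x\<close> is a
    fixed parameter.\<close>
  define P where "P k \<longleftrightarrow> (\<forall>n. n < \<tau> \<longrightarrow> \<bar>(of_anat n * eps \<tau> - x) * of_anat k\<bar> < 1 \<longrightarrow>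
    \<bar>(\<phi> (n + 1) - \<phi> n) * of_anat \<tau> - diff_quot \<tau> f x\<bar> < 1 / of_anat i)" for k
  have "sdef (\<lambda>e. P (toN (e 0)))"
    unfolding P_def by (intro sdef_intros \<phi>)
  moreover have "P k" if k: "k \<notin> FN" for k
    unfolding P_def
  proof (intro allI impI)
    fix n
    assume n: "n < \<tau>" and close: "\<bar>(of_anat n * eps \<tau> - x) * of_anat k\<bar> < 1"
    let ?y = "of_anat n * eps \<tau>"
    have y: "?y \<in> grid \<tau> - {1}" using n grid by blast
    have "x \<doteq> ?y"
      unfolding indisc_def
    \<comment> \<open>The first clause of \<open>\<doteq>\<close> asks for a finite strict bound on
      \<open>x\<close>; since \<open>x\<close> lies between 0 and 1, the number 2 will do.\<close>
    proof (intro disjI1 bexI[of _ "1 + 1"] ballI impI conjI)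
      show "1 + 1 \<in> FN"
        using FN_add_1[OF FN_add_1[OF zero_in_FN]] by simp
      obtain m where m: "m \<le> \<tau>" "x = of_anat m / of_anat \<tau>"
        using x by (auto simp: grid_def)
      then have "0 \<le> x" "x \<le> 1"
        using of_anat_pos[OF \<tau>0] of_anat_le_iff[of 0 m]
        by (simp_all add: divide_le_eq del: of_anat_le_iff) (simp add: m)
      then show "\<bar>x\<bar> < of_anat (1 + 1)"
        unfolding of_anat_hom by linarith
      fix j :: "'a anat"
      assume j: "j \<in> FN" "0 < j"
      \<comment> \<open>Every finite \<open>j\<close> is below the infinite \<open>k\<close>, so the
        single bound with \<open>k\<close> yields all bounds \<open>1 / j\<close>.\<close>
      then have "j < k" using k FN_less by blast
      then have "\<bar>x - ?y\<bar> * of_anat j \<le> \<bar>x - ?y\<bar> * of_anat k"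
        by (intro mult_left_mono) auto
      also have "\<dots> = \<bar>(?y - x) * of_anat k\<bar>"
        using of_anat_le_iff[of 0 k] by (simp add: abs_mult abs_minus_commute del: of_anat_le_iff)
      finally have "\<bar>x - ?y\<bar> * of_anat j < 1"
        using close by (rule le_less_trans)
      moreover have "0 < of_anat j"
        using j(2) by (intro of_anat_pos) auto
      ultimately show "\<bar>x - ?y\<bar> < 1 / of_anat j"
        by (simp add: pos_less_divide_eq)
    qed
    then have "diff_quot \<tau> f x \<doteq> diff_quot \<tau> f ?y"
      using cont x y unfolding indisc_continuous_def by blast
    from indisc_bounded[OF this bounded i]
    show "\<bar>(\<phi> (n + 1) - \<phi> n) * of_anat \<tau> - diff_quot \<tau> f x\<bar> < 1 / of_anat i"
      using quot[OF n] by (simp add: abs_minus_commute)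
  qed
  ultimately obtain k where k: "k \<in> FN" "P k"
    using FN_overspill[of P \<tau>] \<tau> by blast
  show ?thesis
  proof (rule that[OF k(1)])
    fix y
    assume y: "y \<in> grid \<tau> - {1}" and close: "\<bar>(y - x) * of_anat k\<bar> < 1"
    from y obtain n where n: "n < \<tau>" "y = of_anat n * eps \<tau>" using grid by blast
    then show "\<bar>diff_quot \<tau> f y - diff_quot \<tau> f x\<bar> < 1 / of_anat i"
      using k(2) close unfolding P_def by (simp add: quot)
  qed
qed

text \<open>The quotient over the step \<open>t\<close> is the mean of the difference quotients at
  the grid points from \<open>x\<close> up to \<open>x + t - eps \<tau>\<close>, so it stays as
  close to \<open>g\<close> as all of them are.\<close>

lemma increment_bound:
  fixes \<tau> :: "'a::ast anat"
  assumes \<tau>: "\<tau> \<noteq> 0" and f: "rat_function (elts f) (grid \<tau>)"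
    and x: "x \<in> grid \<tau>" and t: "t \<in> grid \<tau>" "t \<noteq> 0" and xt: "x + t \<in> grid \<tau>"
    and close: "\<And>y. y \<in> grid \<tau> - {1} \<Longrightarrow> x \<le> y \<Longrightarrow> y \<le> x + t \<Longrightarrow> \<bar>diff_quot \<tau> f y - g\<bar> \<le> r"
  shows "\<bar>(rapp (elts f) (x + t) - rapp (elts f) x) / t - g\<bar> \<le> r"
proof -
  have pos: "0 < of_anat \<tau>" using \<tau> by (rule of_anat_pos)
  then have eps: "0 < eps \<tau>" "of_anat \<tau> * eps \<tau> = 1" by (simp_all add: eps_def)
  obtain a where a: "a \<le> \<tau>" "x = of_anat a * eps \<tau>" using x by (auto simp: grid_iff)
  obtain m where m: "m \<le> \<tau>" "t = of_anat m * eps \<tau>" using t by (auto simp: grid_iff)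
  obtain b where b: "b \<le> \<tau>" "x + t = of_anat b * eps \<tau>" using xt by (auto simp: grid_iff)
  \<comment> \<open>Comparing numerators shows that \<open>x + t\<close> has index
    \<open>a + m\<close>, which is therefore at most \<open>\<tau>\<close>; the default value of
    \<open>\<phi>\<close> is never met.\<close>
  have "of_anat (a + m) * eps \<tau> = of_anat b * eps \<tau>"
    using a m b by (simp add: distrib_right)
  then have "of_anat (a + m) = of_anat b"
    using eps(1) by simp
  then have am: "a + m \<le> \<tau>"
    using b(1) by (simp only: of_anat_eq_iff)
  have m0: "0 < of_anat m"
    using m t(2) by (intro of_anat_pos) auto
  have tpos: "0 < t"
    using m m0 eps(1) by simp
  define \<phi> where "\<phi> n = (if n \<le> \<tau> then rapp (elts f) (of_anat n * eps \<tau>) else 0)" for n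
  have \<phi>: "qdef (\<lambda>e. \<phi> (a + u e))" if "ndef u" for u
    unfolding \<phi>_def by (intro qdef_grid_values[OF f] sdef_intros that)
  \<comment> \<open>One increment of \<open>f\<close> is \<open>eps \<tau>\<close> times a
    difference quotient, so both \<open>g\<close> and \<open>r\<close> are scaled by
    \<open>eps \<tau>\<close>.\<close>
  have "\<bar>\<phi> (a + m) - \<phi> (a + 0) - of_anat m * (eps \<tau> * g)\<bar> \<le> of_anat m * (eps \<tau> * r)"
  proof (rule telescoping_bound[of "\<lambda>n. \<phi> (a + n)", OF \<phi>])
    fix i
    assume "i < m"
    then have i: "a + i < a + m" by simp
    then have less: "a + i < \<tau>" using am by (rule less_le_trans)
    have le: "a + i + 1 \<le> a + m"
      using i by (rule anat_less_imp_succ_le)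
    let ?y = "of_anat (a + i) * eps \<tau>"
    have "?y < of_anat \<tau> * eps \<tau>"
      using less eps(1) by (intro mult_strict_right_mono) (simp_all only: of_anat_less_iff)
    then have y: "?y \<in> grid \<tau> - {1}"
      using less eps(2) by (auto simp: grid_iff intro!: exI[of _ "a + i"])
    have "of_anat i \<le> of_anat m" "0 \<le> of_anat i"
      using \<open>i < m\<close> of_anat_le_iff[of 0 i] by (simp_all del: of_anat_le_iff add: of_anat_le_iff[of i m])
    then have "x \<le> ?y" "?y \<le> x + t"
      using a m eps(1) by (simp_all add: distrib_right)
    from close[OF y this] have "\<bar>diff_quot \<tau> f ?y - g\<bar> \<le> r" .
    moreover have quot: "diff_quot \<tau> f ?y * eps \<tau> = \<phi> (a + (i + 1)) - \<phi> (a + i)"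
    proof -
      have "?y + eps \<tau> = of_anat (a + (i + 1)) * eps \<tau>"
        by (simp add: algebra_simps)
      moreover have "a + (i + 1) \<le> \<tau>" "a + i \<le> \<tau>"
        using order_trans[OF le am] less by (simp_all add: add.assoc)
      ultimately show ?thesis
        using eps(1) by (simp only: diff_quot_def \<phi>_def) simp
    qed
    ultimately have "\<bar>(diff_quot \<tau> f ?y - g) * eps \<tau>\<bar> \<le> r * eps \<tau>"
      using eps(1) by (simp add: abs_mult mult_right_mono)
    then show "\<bar>\<phi> (a + (i + 1)) - \<phi> (a + i) - eps \<tau> * g\<bar> \<le> eps \<tau> * r"
      unfolding left_diff_distrib quot mult.commute[of g] mult.commute[of r] .
  qed
  then have "\<bar>rapp (elts f) (x + t) - rapp (elts f) x - t * g\<bar> \<le> t * r"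
    using a(1) am by (simp add: \<phi>_def a(2) m(2) distrib_right mult.assoc)
  moreover have "(rapp (elts f) (x + t) - rapp (elts f) x) / t - g
      = (rapp (elts f) (x + t) - rapp (elts f) x - t * g) / t"
    using tpos by (simp add: field_simps)
  ultimately show ?thesis
    using tpos by (simp add: pos_divide_le_eq mult.commute)
qed

theorem theorem6:
  fixes \<tau> :: "'v::ast anat" and \<F> :: "'v set set" and f :: 'v
    and x :: "'v arat" and a :: "'v set"
  assumes "\<tau> \<notin> FN"
    and "ast_differentiable \<tau> \<F>"
    and "grid_represents \<tau> f \<F>"
    and "indisc_continuous (grid \<tau> - {1}) (diff_quot \<tau> f)"
    and "x \<in> grid \<tau>"
    and "diff_quot \<tau> f x \<in> BQ"
    and "rat_sequence a"
    and "\<And>i j. i \<in> FN \<Longrightarrow> j \<in> FN \<Longrightarrow> i < j \<Longrightarrow> seq_nth a j \<le> seq_nth a i"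
    and "\<And>n. n \<in> FN \<Longrightarrow> seq_nth a n \<in> grid \<tau> \<and> seq_nth a n \<noteq> 0
           \<and> x + seq_nth a n \<in> grid \<tau> \<and> \<not> seq_nth a n \<doteq> 0"
    and "converges_to a 0"
  shows "\<forall>q\<in>FQ. q \<noteq> 0 \<longrightarrow> (\<exists>i\<in>FN. \<forall>j\<in>FN. i < j \<longrightarrow>
           \<bar>(rapp (elts f) (x + seq_nth a j) - rapp (elts f) x) / seq_nth a j
              - diff_quot \<tau> f x\<bar> < \<bar>q\<bar>)"
proof (intro ballI impI)
  fix q :: "'v arat"
  assume "q \<in> FQ" "q \<noteq> 0"
  then obtain i where i: "i \<in> FN" "0 < i" "1 / of_anat i < \<bar>q\<bar>"
    by (rule FQ_bound)
  have \<tau>0: "\<tau> \<noteq> 0" using assms(1) zero_in_FN by auto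
  have f: "rat_function (elts f) (grid \<tau>)"
    using assms(3) by (simp add: grid_represents_def)
  have grid: "0 \<le> s \<and> s \<le> 1" if s: "s \<in> grid \<tau>" for s
  proof -
    obtain n where "n \<le> \<tau>" "s = of_anat n / of_anat \<tau>"
      using s by (auto simp: grid_def)
    then show ?thesis
      using of_anat_pos[OF \<tau>0] of_anat_le_iff[of 0 n] by (simp add: divide_le_eq)
  qed
  note seq = assms(9)
  have pos: "0 < seq_nth a n" if "n \<in> FN" for n
    using seq[OF that] grid[of "seq_nth a n"] by auto
  \<comment> \<open>A positive \<open>t\<close> with \<open>x + t\<close> in the grid keeps
    \<open>x\<close> below 1, the point at which \<open>diff_quot\<close> would read
    \<open>f\<close> outside its domain.\<close>
  have "x \<noteq> 1"
    using seq[OF zero_in_FN] pos[OF zero_in_FN] grid[of "x + seq_nth a 0"] by auto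
  then have x: "x \<in> grid \<tau> - {1}"
    using assms(5) by simp
  obtain k where k: "k \<in> FN" "\<And>y. y \<in> grid \<tau> - {1} \<Longrightarrow> \<bar>(y - x) * of_anat k\<bar> < 1
    \<Longrightarrow> \<bar>diff_quot \<tau> f y - diff_quot \<tau> f x\<bar> < 1 / of_anat i"
    using diff_quot_close[OF assms(1) f assms(4) x assms(6) i(1,2)] by blast
  have k0: "0 \<le> of_anat k"
    using of_anat_le_iff[of 0 k] by simp
  have kpos: "0 < of_anat (k + 1)"
    using k0 by (simp add: add_nonneg_pos)
  \<comment> \<open>\<open>k\<close> may be 0, so convergence is invoked with \<open>k + 1\<close>;
    for positive \<open>t\<close>, \<open>t * (k + 1) < 1\<close> still implies
    \<open>t * k < 1\<close>.\<close>
  have "1 / of_anat (k + 1) \<in> FQ"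
    unfolding FQ_def
  proof (intro CollectI bexI conjI disjI1)
    show "1 / of_anat (k + 1) = of_anat 1 / of_anat (k + 1)" by simp
    show "k + 1 \<noteq> 0" by (simp add: asuc_eq[symmetric])
    show "1 \<in> FN" using FN_add_1[OF zero_in_FN] by simp
    show "k + 1 \<in> FN" by (rule FN_add_1[OF k(1)])
  qed
  moreover have "1 / of_anat (k + 1) \<noteq> 0" using kpos by simp
  ultimately obtain N where N: "N \<in> FN"
    "\<And>j. j \<in> FN \<Longrightarrow> N < j \<Longrightarrow> \<bar>seq_nth a j - 0\<bar> < \<bar>1 / of_anat (k + 1)\<bar>"
    using assms(10) unfolding converges_to_def by blast
  show "\<exists>i\<in>FN. \<forall>j\<in>FN. i < j \<longrightarrow>
      \<bar>(rapp (elts f) (x + seq_nth a j) - rapp (elts f) x) / seq_nth a j - diff_quot \<tau> f x\<bar> < \<bar>q\<bar>"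
  proof (intro bexI[OF _ N(1)] ballI impI)
    fix j
    assume j: "j \<in> FN" "N < j"
    let ?t = "seq_nth a j"
    have t: "0 < ?t" "?t \<in> grid \<tau>" "?t \<noteq> 0" "x + ?t \<in> grid \<tau>"
      using seq[OF j(1)] pos[OF j(1)] by auto
    have "?t < 1 / of_anat (k + 1)"
      using N(2)[OF j] t(1) kpos by simp
    then have "?t * of_anat (k + 1) < 1"
      using kpos by (simp only: pos_less_divide_eq)
    then have tk: "?t * of_anat k < 1"
      using t(1) by (simp add: distrib_left)
    have "\<bar>diff_quot \<tau> f y - diff_quot \<tau> f x\<bar> \<le> 1 / of_anat i"
      if y: "y \<in> grid \<tau> - {1}" "x \<le> y" "y \<le> x + ?t" for y
    proof -
      have "\<bar>(y - x) * of_anat k\<bar> = (y - x) * of_anat k"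
        using y(2) k0 by simp
      also have "\<dots> \<le> ?t * of_anat k"
        using y(3) k0 by (intro mult_right_mono) (simp_all add: algebra_simps)
      finally have "\<bar>(y - x) * of_anat k\<bar> < 1"
        using tk by (rule le_less_trans)
      then show ?thesis
        using k(2)[OF y(1)] by (simp add: less_imp_le)
    qed
    then have "\<bar>(rapp (elts f) (x + ?t) - rapp (elts f) x) / ?t - diff_quot \<tau> f x\<bar> \<le> 1 / of_anat i"
      by (rule increment_bound[OF \<tau>0 f assms(5) t(2-4)])
    also have "\<dots> < \<bar>q\<bar>" by (rule i(3))
    finally show "\<bar>(rapp (elts f) (x + ?t) - rapp (elts f) x) / ?t - diff_quot \<tau> f x\<bar> < \<bar>q\<bar>" .
  qed
qed

end
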